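(* Let $X,X_1,X_2,\ldots$ be real valued i.i.d. random variables with mean $0$ and variance $\sigma^2$, $0<\sigma^2<\infty$. Let $\{v_1^{(n)},\ldots,v_n^{(n)}\}_{n\ge 1}$ be vectors of non-negative random weights (not assumed exchangeable), independent of the data sequence $\{X_1,\ldots,X_n\}_{n\ge1}$, and put $m_n=\sum_{i=1}^n v_i^{(n)}$, $m_n\ge 1$. Put $$V_{i,n}:=\Big|\Big(\frac{v_i^{(n)}}{m_n}-\frac1n\Big)X_i\Big|\ (1\le i\le n),\qquad V_n^2:=\sum_{i=1}^n\Big(\frac{v_i^{(n)}}{m_n}-\frac1n\Big)^2,\qquad M_n:=\frac{\max_{1\le i\le n}\big(\frac{v_i^{(n)}}{m_n}-\frac1n\big)^2}{\sum_{i=1}^n\big(\frac{v_i^{(n)}}{m_n}-\frac1n\big)^2},$$ and let $Z$ be a standard normal random variable. All limits below are as $n,m_n\to\infty$. (I) $M_n=o(1)$ a.s.-$P_v$ if and only if the following two statements hold simultaneously: $$P_{X|v}(T^*_{m_n}\le t)\to P(Z\le t)\ \text{ a.s.-}P_v\ \text{ for all } t\in\mathbb R,$$ $$\max_{1\le i\le n}P_{X|v}\big(V_{i,n}/(S_nV_n)>\varepsilon\big)=o(1)\ \text{ a.s.-}P_v\ \text{ for all }\varepsilon>0.$$ (II) $M_n=o_{P_v}(1)$ if and only if the following two statements hold simultaneously: $$P_{X|v}(T^*_{m_n}\le t)\to P(Z\le t)\ \text{ in probability-}P_v\ \text{ for all } t\in\mathbb R,$$ $$\max_{1\le i\le n}P_{X|v}\big(V_{i,n}/(S_nV_n)>\varepsilon\big)=o_{P_v}(1)\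 \text{ for all }\varepsilon>0.$$ (III) Assume moreover that for any $\varepsilon>0$, $$P_{X|v}\Big(\Big|\frac{S_{m_n}^{*2}/m_n}{\sigma^2\sum_{i=1}^n\big(\frac{v_i^{(n)}}{m_n}-\frac1n\big)^2}-1\Big|>\varepsilon\Big)=o(1)\ \text{ a.s.-}P_v.$$ Then $M_n=o(1)$ a.s.-$P_v$ is also equivalent to having simultaneously $$P_{X|v}(T^{**}_{m_n}\le t)\to P(Z\le t)\ \text{ a.s.-}P_v\ \text{ for all } t\in\mathbb R,$$ $$\max_{1\le i\le n}P_{X|v}\big(V_{i,n}/(S^*_{m_n}/\sqrt{m_n})>\varepsilon\big)=o(1)\ \text{ a.s.-}P_v\ \text{ for all }\varepsilon>0.$$ (IV) Assume instead that for any $\varepsilon>0$, $$P_{X|v}\Big(\Big|\frac{S_{m_n}^{*2}/m_n}{\sigma^2\sum_{i=1}^n\big(\frac{v_i^{(n)}}{m_n}-\frac1n\big)^2}-1\Big|>\varepsilon\Big)=o_{P_v}(1).$$ Then $M_n=o_{P_v}(1)$ is also equivalent to having simultaneously $$P_{X|v}(T^{**}_{m_n}\le t)\to P(Z\le t)\ \text{ in probability-}P_v\ \text{ for all } t\in\mathbb R,$$ $$\max_{1\le i\le n}P_{X|v}\big(V_{i,n}/(S^*_{m_n}/\sqrt{m_n})>\varepsilon\big)=o_{P_v}(1)\ \text{ for all }\varepsilon>0.$$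
   Context: The data $X,X_1,X_2,\dots$ live on $(\Omega_X,\mathcal F_X,P_X)$, the triangular array of weights on $(\Omega_v,\mathcal F_v,P_v)$, and jointly they live on the product space with $P_{X,v}=P_X\times P_v$. $P_{X|v}(\cdot)$ denotes conditional probability given $\sigma(v_1^{(n)},\ldots,v_n^{(n)})$. Put $\bar X_n=\frac1n\sum_{i=1}^nX_i$, $\bar X^*_{m_n}=\frac1{m_n}\sum_{i=1}^n v_i^{(n)}X_i$, $S_n^2=\frac1n\sum_{i=1}^n(X_i-\bar X_n)^2$ and $S^{*2}_{m_n}=\frac1{m_n}\sum_{i=1}^n v_i^{(n)}(X_i-\bar X^*_{m_n})^2$ (for re-sampling, where $v_i^{(n)}$ counts how often $X_i$ is drawn, this is the sample variance, with divisor $m_n$, of the bootstrap sample $X_1^*,\dots,X_{m_n}^*$). The bootstrapped $t$-statistics are $$T^*_{m_n}=\frac{\sum_{i=1}^n\big(\frac{v_i^{(n)}}{m_n}-\frac1n\big)X_i}{S_n\sqrt{\sum_{i=1}^n\big(\frac{v_i^{(n)}}{m_n}-\frac1n\big)^2}},\qquad T^{**}_{m_n}=\frac{\sum_{i=1}^n\big(\frac{v_i^{(n)}}{m_n}-\frac1n\big)X_i}{S^*_{m_n}/\sqrt{m_n}}.$$ It is understood that $V_n>0$ ($P_v$-a.s.), so that the quotients defining $M_n$ and $T^*_{m_n}$ make sense, and, when $m_n$ is random, $m_n\to\infty$ is understood $P_v$-a.s. *)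

theory Defs
  imports "HOL-Probability.Probability"
begin

text \<open>
  The data are \<open>X i\<close> with \<open>i \<ge> 1\<close>, on \<open>PX\<close>; the weights are \<open>v n i\<close> with \<open>1 \<le> i \<le> n\<close>, on \<open>Pv\<close>.
  Data and weights are independent because they live on the two factors of \<open>PX \<Otimes>\<^sub>M Pv\<close>;
  statistics take the two coordinates \<open>x\<close> and \<open>w\<close> as separate arguments.
\<close>

definition m_tot :: "(nat \<Rightarrow> nat \<Rightarrow> 'b \<Rightarrow> real) \<Rightarrow> nat \<Rightarrow> 'b \<Rightarrow> real" where
  "m_tot v n w = (\<Sum>i=1..n. v n i w)"

definition cwt :: "(nat \<Rightarrow> nat \<Rightarrow> 'b \<Rightarrow> real) \<Rightarrow> nat \<Rightarrow> nat \<Rightarrow> 'b \<Rightarrow> real" where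
  "cwt v n i w = v n i w / m_tot v n w - 1 / real n"

definition V_norm :: "(nat \<Rightarrow> nat \<Rightarrow> 'b \<Rightarrow> real) \<Rightarrow> nat \<Rightarrow> 'b \<Rightarrow> real" where
  "V_norm v n w = sqrt (\<Sum>i=1..n. (cwt v n i w)\<^sup>2)"

definition M_ratio :: "(nat \<Rightarrow> nat \<Rightarrow> 'b \<Rightarrow> real) \<Rightarrow> nat \<Rightarrow> 'b \<Rightarrow> real" where
  "M_ratio v n w = (MAX i\<in>{1..n}. (cwt v n i w)\<^sup>2) / (\<Sum>i=1..n. (cwt v n i w)\<^sup>2)"

definition V_abs ::
  "(nat \<Rightarrow> 'a \<Rightarrow> real) \<Rightarrow> (nat \<Rightarrow> nat \<Rightarrow> 'b \<Rightarrow> real) \<Rightarrow> nat \<Rightarrow> nat \<Rightarrow> 'a \<Rightarrow> 'b \<Rightarrow> real" where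
  "V_abs X v n i x w = \<bar>cwt v n i w * X i x\<bar>"

definition sample_mean :: "(nat \<Rightarrow> 'a \<Rightarrow> real) \<Rightarrow> nat \<Rightarrow> 'a \<Rightarrow> real" where
  "sample_mean X n x = (1 / real n) * (\<Sum>i=1..n. X i x)"

definition sample_sd :: "(nat \<Rightarrow> 'a \<Rightarrow> real) \<Rightarrow> nat \<Rightarrow> 'a \<Rightarrow> real" where
  "sample_sd X n x = sqrt ((1 / real n) * (\<Sum>i=1..n. (X i x - sample_mean X n x)\<^sup>2))"

definition boot_mean ::
  "(nat \<Rightarrow> 'a \<Rightarrow> real) \<Rightarrow> (nat \<Rightarrow> nat \<Rightarrow> 'b \<Rightarrow> real) \<Rightarrow> nat \<Rightarrow> 'a \<Rightarrow> 'b \<Rightarrow> real" where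
  "boot_mean X v n x w = (1 / m_tot v n w) * (\<Sum>i=1..n. v n i w * X i x)"

definition boot_var ::
  "(nat \<Rightarrow> 'a \<Rightarrow> real) \<Rightarrow> (nat \<Rightarrow> nat \<Rightarrow> 'b \<Rightarrow> real) \<Rightarrow> nat \<Rightarrow> 'a \<Rightarrow> 'b \<Rightarrow> real" where
  "boot_var X v n x w =
     (1 / m_tot v n w) * (\<Sum>i=1..n. v n i w * (X i x - boot_mean X v n x w)\<^sup>2)"

definition boot_se ::
  "(nat \<Rightarrow> 'a \<Rightarrow> real) \<Rightarrow> (nat \<Rightarrow> nat \<Rightarrow> 'b \<Rightarrow> real) \<Rightarrow> nat \<Rightarrow> 'a \<Rightarrow> 'b \<Rightarrow> real" where
  "boot_se X v n x w = sqrt (boot_var X v n x w) / sqrt (m_tot v n w)"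

definition T_star ::
  "(nat \<Rightarrow> 'a \<Rightarrow> real) \<Rightarrow> (nat \<Rightarrow> nat \<Rightarrow> 'b \<Rightarrow> real) \<Rightarrow> nat \<Rightarrow> 'a \<Rightarrow> 'b \<Rightarrow> real" where
  "T_star X v n x w = (\<Sum>i=1..n. cwt v n i w * X i x) / (sample_sd X n x * V_norm v n w)"

definition T_star_star ::
  "(nat \<Rightarrow> 'a \<Rightarrow> real) \<Rightarrow> (nat \<Rightarrow> nat \<Rightarrow> 'b \<Rightarrow> real) \<Rightarrow> nat \<Rightarrow> 'a \<Rightarrow> 'b \<Rightarrow> real" where
  "T_star_star X v n x w = (\<Sum>i=1..n. cwt v n i w * X i x) / boot_se X v n x w"

definition sigma_weights ::
  "'a measure \<Rightarrow> 'b measure \<Rightarrow> (nat \<Rightarrow> nat \<Rightarrow> 'b \<Rightarrow> real) \<Rightarrow> nat \<Rightarrow> ('a \<times> 'b) measure" where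
  "sigma_weights PX Pv v n = sigma (space (PX \<Otimes>\<^sub>M Pv))
     (\<Union>i\<in>{1..n}. {(\<lambda>z. v n i (snd z)) -` B \<inter> space (PX \<Otimes>\<^sub>M Pv) | B. B \<in> sets borel})"

text \<open>
  \<open>P_X_given_v PX Pv v n Q\<close> is the conditional probability of the event \<open>Q\<close> on the product space
  given the weights \<open>v n 1, \<dots>, v n n\<close>. Being measurable with respect to \<open>sigma_weights\<close>, the
  conditional expectation does not depend on the data coordinate \<open>x\<close>
  (see \<open>P_X_given_v_eq\<close>), so it is regarded as a function of \<open>w\<close> alone.
\<close>

definition P_X_given_v ::
  "'a measure \<Rightarrow> 'b measure \<Rightarrow> (nat \<Rightarrow> nat \<Rightarrow> 'b \<Rightarrow> real) \<Rightarrow> nat \<Rightarrow> ('a \<Rightarrow> 'b \<Rightarrow> bool) \<Rightarrow> 'b \<Rightarrow> real" where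
  "P_X_given_v PX Pv v n Q w = (THE c. \<forall>x\<in>space PX.
     real_cond_exp (PX \<Otimes>\<^sub>M Pv) (sigma_weights PX Pv v n)
       (indicator {z \<in> space (PX \<Otimes>\<^sub>M Pv). Q (fst z) (snd z)}) (x, w) = c)"

lemma sigma_weights_fibre:
  assumes A: "A \<in> sets (sigma_weights PX Pv v n)"
    and x: "x \<in> space PX" "x' \<in> space PX" and w: "w \<in> space Pv"
  shows "(x, w) \<in> A \<longleftrightarrow> (x', w) \<in> A"
proof -
  let ?S = "space (PX \<Otimes>\<^sub>M Pv)"
  let ?G = "\<Union>i\<in>{1..n}. {(\<lambda>z. v n i (snd z)) -` B \<inter> ?S | B. B \<in> sets borel}"
  have sub: "?G \<subseteq> Pow ?S" by auto
  have "A \<in> sigma_sets ?S ?G"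
    using A sets_measure_of[OF sub] by (simp add: sigma_weights_def)
  then show ?thesis
  proof induction
    case (Basic a)
    then show ?case using x w by (auto simp: space_pair_measure)
  next
    case Empty
    then show ?case by simp
  next
    case (Compl a)
    then show ?case using x w by (auto simp: space_pair_measure)
  next
    case (Union a)
    then show ?case by blast
  qed
qed

lemma P_X_given_v_eq:
  assumes x: "x \<in> space PX" and w: "w \<in> space Pv"
  shows "P_X_given_v PX Pv v n Q w =
    real_cond_exp (PX \<Otimes>\<^sub>M Pv) (sigma_weights PX Pv v n)
      (indicator {z \<in> space (PX \<Otimes>\<^sub>M Pv). Q (fst z) (snd z)}) (x, w)"
proof -
  let ?F = "sigma_weights PX Pv v n"
  let ?f = "real_cond_exp (PX \<Otimes>\<^sub>M Pv) ?F
    (indicator {z \<in> space (PX \<Otimes>\<^sub>M Pv). Q (fst z) (snd z)})"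
  have sp: "space ?F = space PX \<times> space Pv"
    unfolding sigma_weights_def
    by (subst space_measure_of) (auto simp: space_pair_measure)
  have f_meas: "?f \<in> borel_measurable ?F"
    by (rule borel_measurable_cond_exp)
  have const: "?f (x', w) = ?f (x, w)" if x': "x' \<in> space PX" for x'
  proof -
    have level: "?f -` {?f (x, w)} \<inter> space ?F \<in> sets ?F"
      by (rule measurable_sets[OF f_meas borel_singleton[OF sets.empty_sets]])
    have "(x, w) \<in> ?f -` {?f (x, w)} \<inter> space ?F"
      unfolding sp using x w by blast
    then have "(x', w) \<in> ?f -` {?f (x, w)} \<inter> space ?F"
      using sigma_weights_fibre[OF level x x' w] by blast
    then show ?thesis by blast
  qed
  show ?thesis
    unfolding P_X_given_v_def
  proof (rule the_equality)
    show "\<forall>x'\<in>space PX. ?f (x', w) = ?f (x, w)"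
      using const by blast
    show "c = ?f (x, w)" if "\<forall>x'\<in>space PX. ?f (x', w) = c" for c
      using bspec[OF that x] by (rule sym)
  qed
qed

definition tendsto_as :: "'b measure \<Rightarrow> (nat \<Rightarrow> 'b \<Rightarrow> real) \<Rightarrow> real \<Rightarrow> bool" where
  "tendsto_as P Y c \<longleftrightarrow> (AE w in P. (\<lambda>n. Y n w) \<longlonglongrightarrow> c)"

definition tendsto_in_prob :: "'b measure \<Rightarrow> (nat \<Rightarrow> 'b \<Rightarrow> real) \<Rightarrow> real \<Rightarrow> bool" where
  "tendsto_in_prob P Y c \<longleftrightarrow>
     (\<forall>\<delta>>0. (\<lambda>n. measure P {w \<in> space P. \<bar>Y n w - c\<bar> > \<delta>}) \<longlonglongrightarrow> 0)"

end

theory Submission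
  imports Defs
begin

text \<open>
  For fixed weights put \<open>a\<^sub>i = cwt v n i w / V_norm v n w\<close>. These numbers satisfy
  \<open>\<Sum> a\<^sub>i\<^sup>2 = 1\<close> and \<open>M_ratio v n w = max a\<^sub>i\<^sup>2\<close>, and both \<open>t\<close>-statistics have the form
  \<open>(\<Sum> a\<^sub>i X\<^sub>i) / D\<close> with \<open>D = sample_sd\<close> for \<open>T_star\<close> and \<open>D = boot_se / V_norm\<close> for
  \<open>T_star_star\<close>. In both cases \<open>D\<close> is close to \<open>\<sigma>\<close> in probability: in the first by the weak law of
  large numbers (\<open>sample_sd_consistent\<close>), in the second by the extra assumption on the bootstrap
  variance (\<open>boot_se_conditionally_consistent\<close>). So a single equivalence for a general
  denominator, \<open>clt_iff_small_weights\<close>, gives all four parts.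

  Behind it are three statements about fixed real weights and the data alone.
  If \<open>max a\<^sub>i\<^sup>2\<close> is small, the characteristic function of \<open>\<Sum> a\<^sub>i X\<^sub>i / \<sigma>\<close> is a product of factors that are
  within \<open>\<epsilon> a\<^sub>i\<^sup>2\<close> of Gaussian ones, hence is within \<open>\<epsilon>\<close> of the Gaussian one; Levy's continuity theorem
  and a Slutsky argument turn this into closeness of distribution functions
  (\<open>studentized_sum_clt\<close>). Small \<open>max a\<^sub>i\<^sup>2\<close> also makes every summand negligible, by Chebyshev's
  inequality (\<open>small_weights_imp_negligible\<close>). Conversely \<open>X\<^sub>i\<close> has a fixed non-degenerate law, so a
  summand \<open>a\<^sub>i X\<^sub>i\<close> with \<open>a\<^sub>i\<close> bounded away from \<open>0\<close> cannot be negligible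
  (\<open>negligible_imp_small_weights\<close>).

  All three are stated as \<open>\<epsilon>\<close>-\<open>\<eta>\<close> implications that are uniform in \<open>n\<close>, in the weights and in the
  denominator. Such an implication applies to each realization of the weights, and it transports null sequences
  equally well almost surely and in probability. The two modes are therefore treated as instances of one
  abstract notion of limit (\<open>limit_mode\<close>).

  The link with \<open>P_X_given_v\<close> is Fubini's theorem: given the weights, the conditional probability of
  an event is the \<open>PX\<close>-measure of its section (\<open>P_X_given_v_eq_section_prob\<close>).
\<close>

section \<open>Characteristic functions near the origin\<close>

text \<open>
  The remainder in \<open>char_approx2\<close> is \<open>\<bar>t\<bar>^n\<close> times the mean of a minimum that tends to \<open>0\<close>
  with \<open>t\<close> under an integrable bound. A moment of order \<open>n\<close> thus gives a remainder \<open>o(\<bar>t\<bar>^n)\<close>;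
  it is used with \<open>n = 1\<close> for the law of large numbers and with \<open>n = 2\<close> for the central limit
  theorem.
\<close>

lemma (in real_distribution) char_taylor_remainder_small:
  assumes moments: "\<And>k. k \<le> n \<Longrightarrow> integrable M (\<lambda>x. x ^ k)" and \<epsilon>: "\<epsilon> > 0"
  shows "\<exists>\<eta>>0. \<forall>t. \<bar>t\<bar> \<le> \<eta> \<longrightarrow>
    cmod (char M t - (\<Sum>k\<le>n. ((\<i> * t) ^ k / fact k) * expectation (\<lambda>x. x ^ k))) \<le> \<epsilon> * \<bar>t\<bar> ^ n"
proof -
  define h where "h t = expectation (\<lambda>x. min (2 * \<bar>x\<bar> ^ n * Suc n) (\<bar>t\<bar> * \<bar>x\<bar> ^ Suc n))" for t
  have dom: "integrable M (\<lambda>x. 2 * \<bar>x\<bar> ^ n * Suc n)"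
    using integrable_abs[OF moments[of n]] by (simp add: power_abs)
  have int: "integrable M (\<lambda>x. min (2 * \<bar>x\<bar> ^ n * Suc n) (\<bar>t\<bar> * \<bar>x\<bar> ^ Suc n))" for t
    by (rule Bochner_Integration.integrable_bound[OF dom]) (auto simp: abs_mult)
  have "(\<lambda>k. h (1 / Suc k)) \<longlonglongrightarrow> expectation (\<lambda>x. 0)"
    unfolding h_def
  proof (rule integral_dominated_convergence[OF _ _ dom])
    show "AE x in M. (\<lambda>k. min (2 * \<bar>x\<bar> ^ n * Suc n) (\<bar>1 / Suc k\<bar> * \<bar>x\<bar> ^ Suc n)) \<longlonglongrightarrow> 0"
    proof (intro AE_I2)
      fix x :: real
      have "(\<lambda>k. \<bar>1 / Suc k\<bar> * \<bar>x\<bar> ^ Suc n) \<longlonglongrightarrow> 0 * \<bar>x\<bar> ^ Suc n"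
        by (intro tendsto_mult tendsto_const tendsto_rabs_zero LIMSEQ_Suc[OF lim_const_over_n])
      then show "(\<lambda>k. min (2 * \<bar>x\<bar> ^ n * Suc n) (\<bar>1 / Suc k\<bar> * \<bar>x\<bar> ^ Suc n)) \<longlonglongrightarrow> 0"
        by (intro tendsto_min[OF tendsto_const, THEN tendsto_eq_rhs]) (auto simp: min_absorb2)
    qed
  qed (auto simp: abs_mult)
  then have "\<forall>\<^sub>F k in sequentially. h (1 / Suc k) < \<epsilon>"
    using \<epsilon> by (intro order_tendstoD(2)) auto
  then obtain k where k: "h (1 / Suc k) < \<epsilon>"
    by (meson eventually_sequentially order_refl)
  have "cmod (char M t - (\<Sum>k\<le>n. ((\<i> * t) ^ k / fact k) * expectation (\<lambda>x. x ^ k))) \<le> \<epsilon> * \<bar>t\<bar> ^ n"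
    if t: "\<bar>t\<bar> \<le> 1 / Suc k" for t
  proof -
    have "h t \<le> h (1 / Suc k)"
      unfolding h_def using t by (intro integral_mono int min.mono mult_right_mono) auto
    then have "h t \<le> \<epsilon>" using k by simp
    have "h t \<ge> 0" unfolding h_def by (intro integral_nonneg_AE AE_I2) auto
    have "cmod (char M t - (\<Sum>k\<le>n. ((\<i> * t) ^ k / fact k) * expectation (\<lambda>x. x ^ k)))
        \<le> (\<bar>t\<bar> ^ n / fact (Suc n)) * h t"
      unfolding h_def by (rule char_approx2[OF moments])
    also have "\<dots> \<le> \<bar>t\<bar> ^ n / 1 * \<epsilon>"
      by (intro mult_mono divide_left_mono \<open>h t \<le> \<epsilon>\<close> \<open>h t \<ge> 0\<close> fact_ge_1) auto
    finally show ?thesis by (simp add: mult.commute)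
  qed
  then show ?thesis
    by (intro exI[of _ "1 / Suc k"]) auto
qed

text \<open>
  A centered law with variance \<open>\<sigma>\<^sup>2\<close> and the normal law with the same variance share the
  second order Taylor polynomial of the characteristic function. Comparing with the
  exponential itself, rather than with \<open>1 - \<sigma>\<^sup>2 u\<^sup>2 / 2\<close>, pays off for weighted sums: the
  product of these exponentials depends on the weights only through the sum of their squares.
\<close>

lemma char_gaussian_step:
  assumes \<mu>: "real_distribution \<mu>" and int1: "integrable \<mu> (\<lambda>x. x)" and int2: "integrable \<mu> (\<lambda>x. x\<^sup>2)"
    and m1: "(\<integral>x. x \<partial>\<mu>) = 0" and m2: "(\<integral>x. x\<^sup>2 \<partial>\<mu>) = \<sigma>\<^sup>2" and \<epsilon>: "\<epsilon> > 0"
  shows "\<exists>\<eta>>0. \<forall>u. \<bar>u\<bar> \<le> \<eta> \<longrightarrow> cmod (char \<mu> u - complex_of_real (exp (- (\<sigma>\<^sup>2 * u\<^sup>2 / 2)))) \<le> \<epsilon> * u\<^sup>2"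
proof -
  interpret \<mu>: real_distribution \<mu> by fact
  have "\<exists>\<eta>>0. \<forall>t. \<bar>t\<bar> \<le> \<eta> \<longrightarrow>
    cmod (char \<mu> t - (\<Sum>k\<le>2. ((\<i> * t) ^ k / fact k) * \<mu>.expectation (\<lambda>x. x ^ k))) \<le> \<epsilon>/2 * \<bar>t\<bar> ^ 2"
  proof (rule \<mu>.char_taylor_remainder_small)
    fix k :: nat assume "k \<le> 2"
    then consider "k = 0" | "k = 1" | "k = 2" by linarith
    then show "integrable \<mu> (\<lambda>x. x ^ k)" using int1 int2 by cases auto
  qed (use \<epsilon> in auto)
  then obtain \<eta> where \<eta>: "\<eta> > 0" and *: "\<And>t. \<bar>t\<bar> \<le> \<eta> \<Longrightarrow>
    cmod (char \<mu> t - (\<Sum>k\<le>2. ((\<i> * t) ^ k / fact k) * \<mu>.expectation (\<lambda>x. x ^ k))) \<le> \<epsilon>/2 * \<bar>t\<bar> ^ 2"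
    by blast
  have taylor: "(\<Sum>k\<le>2. ((\<i> * t) ^ k / fact k) * \<mu>.expectation (\<lambda>x. x ^ k))
      = complex_of_real (1 - \<sigma>\<^sup>2 * t\<^sup>2 / 2)" for t :: real
  proof -
    have "{..2::nat} = {0, 1, 2}" by auto
    then show ?thesis
      using m1 m2 \<mu>.prob_space \<mu>.space_eq_univ by (simp add: power_mult_distrib)
  qed
  define b where "b = \<sigma>^2 / 2"
  have b: "b \<ge> 0" by (simp add: b_def)
  \<comment> \<open>For \<open>\<bar>u\<bar> \<le> \<eta>'\<close> the Taylor remainder and the error \<open>y\<^sup>2\<close> of \<open>exp (- y)\<close> are each at most \<open>\<epsilon> / 2 * u\<^sup>2\<close>.\<close>
  define \<eta>' where "\<eta>' = min \<eta> (sqrt (\<epsilon> / (2 * (b\<^sup>2 + 1))))"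
  have "\<eta>' > 0" using \<eta> \<epsilon> by (auto simp: \<eta>'_def intro!: divide_pos_pos add_nonneg_pos)
  moreover have "cmod (char \<mu> u - complex_of_real (exp (- (\<sigma>\<^sup>2 * u\<^sup>2 / 2)))) \<le> \<epsilon> * u\<^sup>2"
    if u: "\<bar>u\<bar> \<le> \<eta>'" for u
  proof -
    define y where "y = b * u\<^sup>2"
    have y: "y \<ge> 0" using b by (simp add: y_def)
    have exp_le: "\<bar>(1 - y) - exp (- y)\<bar> \<le> y\<^sup>2"
    proof -
      have "1 - y \<le> exp (- y)" using exp_ge_add_one_self[of "- y"] by simp
      moreover have "exp (- y) \<le> 1 - y + y\<^sup>2"
      proof -
        have "(1 + y) * exp (- y) \<le> exp y * exp (- y)"
          by (intro mult_right_mono exp_ge_add_one_self) auto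
        then have "exp (- y) \<le> 1 / (1 + y)" using y by (simp add: exp_minus field_simps)
        also have "\<dots> \<le> 1 - y + y\<^sup>2"
          using y by (simp add: field_simps power2_eq_square)
        finally show ?thesis .
      qed
      ultimately show ?thesis by simp
    qed
    have "u\<^sup>2 \<le> (sqrt (\<epsilon> / (2 * (b\<^sup>2 + 1))))\<^sup>2"
      using u \<epsilon> unfolding \<eta>'_def by (intro power2_le_iff_abs_le[THEN iffD2]) (auto intro!: divide_nonneg_nonneg)
    also have "\<dots> = \<epsilon> / (2 * (b\<^sup>2 + 1))" using \<epsilon> by simp
    finally have "2 * (b\<^sup>2 + 1) * u\<^sup>2 \<le> \<epsilon>"
      by (simp add: pos_le_divide_eq add_nonneg_pos mult.commute)
    then have "2 * b\<^sup>2 * u\<^sup>2 \<le> \<epsilon>" by (simp add: algebra_simps) (smt (verit) zero_le_power2)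
    then have "2 * b\<^sup>2 * u\<^sup>2 * u\<^sup>2 \<le> \<epsilon> * u\<^sup>2" by (intro mult_right_mono) auto
    then have y2: "y\<^sup>2 \<le> \<epsilon>/2 * u\<^sup>2" by (simp add: y_def power_mult_distrib power2_eq_square mult_ac)
    have eq: "\<sigma>\<^sup>2 * u\<^sup>2 / 2 = y" by (simp add: y_def b_def)
    have "cmod (char \<mu> u - complex_of_real (exp (- y)))
        \<le> cmod (char \<mu> u - complex_of_real (1 - y)) + cmod (complex_of_real (1 - y) - complex_of_real (exp (- y)))"
      by (rule order_trans[OF _ norm_triangle_ineq]) simp
    also have "cmod (char \<mu> u - complex_of_real (1 - y)) \<le> \<epsilon>/2 * u\<^sup>2"
      using *[of u] u unfolding taylor eq \<eta>'_def by simp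
    also have "cmod (complex_of_real (1 - y) - complex_of_real (exp (- y))) \<le> \<epsilon>/2 * u\<^sup>2"
      unfolding of_real_diff[symmetric] norm_of_real using exp_le y2 by linarith
    finally show ?thesis unfolding eq by simp
  qed
  ultimately show ?thesis by blast
qed

lemma isCont_cdf_std_normal: "isCont (cdf std_normal_distribution) x"
proof -
  interpret real_distribution std_normal_distribution by (rule real_dist_normal_dist)
  have "emeasure std_normal_distribution {x} = 0"
    by (subst emeasure_density) (auto simp: nn_integral_0_iff_AE intro!: AE_mp[OF AE_lborel_singleton[of x]])
  then show ?thesis by (simp add: isCont_cdf measure_def)
qed

section \<open>Weighted sums of independent identically distributed variables\<close>

lemma (in prob_space) char_weighted_sum_iid:
  fixes Y :: "nat \<Rightarrow> 'a \<Rightarrow> real"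
  assumes indep: "indep_vars (\<lambda>i. borel) Y {1..}"
    and ident: "\<And>i. i \<ge> 1 \<Longrightarrow> distr M borel (Y i) = \<mu>"
  shows "char (distr M borel (\<lambda>x. \<Sum>i=1..n. a i * Y i x)) t = (\<Prod>i=1..n. char \<mu> (a i * t))"
proof -
  have rv: "random_variable borel (Y i)" if "i \<ge> 1" for i
    using indep that unfolding indep_vars_def2 by auto
  have "indep_vars (\<lambda>i. borel) (\<lambda>i x. a i * Y i x) {1..n}"
    by (rule indep_vars_compose2[OF indep_vars_subset[OF indep]]) auto
  then have "char (distr M borel (\<lambda>x. \<Sum>i=1..n. a i * Y i x)) t
      = (\<Prod>i=1..n. char (distr M borel (\<lambda>x. a i * Y i x)) t)"
    by (rule char_distr_sum)
  also have "\<dots> = (\<Prod>i=1..n. char \<mu> (a i * t))"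
  proof (rule prod.cong[OF refl])
    fix i assume "i \<in> {1..n}"
    then have i: "i \<ge> 1" by simp
    note rv[OF i, measurable]
    show "char (distr M borel (\<lambda>x. a i * Y i x)) t = char \<mu> (a i * t)"
      unfolding ident[OF i, symmetric] char_def by (simp add: integral_distr mult_ac)
  qed
  finally show ?thesis .
qed

lemma (in prob_space) cdf_distr_eq_prob:
  assumes "random_variable borel f"
  shows "cdf (distr M borel f) t = prob {x \<in> space M. f x \<le> t}"
  using assms by (simp add: cdf_def measure_distr vimage_def Int_def conj_commute)

text \<open>
  Only a first moment is assumed, because the law is also applied to the squares of the data,
  which need not have a variance. The characteristic function of the average is \<open>\<phi>(t / n)^n\<close>
  with \<open>\<phi>(u) = 1 + o(u)\<close>, hence tends to \<open>1\<close>, the characteristic function of the point mass at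
  \<open>0\<close>.
\<close>

lemma (in prob_space) weak_law_of_large_numbers_centered:
  fixes Y :: "nat \<Rightarrow> 'a \<Rightarrow> real"
  assumes indep: "indep_vars (\<lambda>i. borel) Y {1..}"
    and ident: "\<And>i. i \<ge> 1 \<Longrightarrow> distr M borel (Y i) = distr M borel (Y 1)"
    and int: "integrable M (Y 1)" and mean: "expectation (Y 1) = 0" and \<epsilon>: "\<epsilon> > 0"
  shows "(\<lambda>n. prob {x \<in> space M. \<bar>1 / real n * (\<Sum>i=1..n. Y i x)\<bar> > \<epsilon>}) \<longlonglongrightarrow> 0"
proof -
  define \<mu> where "\<mu> = distr M borel (Y 1)"
  have rv [measurable]: "random_variable borel (Y i)" if "i \<in> {1..n}" for i n
    using indep that unfolding indep_vars_def2 by auto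
  have rv1 [measurable]: "random_variable borel (Y 1)" by (rule borel_measurable_integrable[OF int])
  interpret \<mu>: real_distribution \<mu>
    unfolding \<mu>_def by (rule real_distribution_distr[OF rv1])
  have \<mu>_int: "integrable \<mu> (\<lambda>x. x)" and \<mu>_mean: "\<mu>.expectation (\<lambda>x. x) = 0"
    unfolding \<mu>_def using int mean by (simp_all add: integrable_distr_eq integral_distr)
  define D where "D n = distr M borel (\<lambda>x. \<Sum>i=1..n. 1 / real n * Y i x)" for n
  have D: "real_distribution (D n)" for n
    unfolding D_def by (rule real_distribution_distr) measurable
  interpret R: prob_space "return borel (0::real)" by (rule prob_space_return) simp
  have R: "real_distribution (return borel (0::real))"
    by unfold_locales simp_all
  have char_R: "char (return borel 0) t = 1" for t
    unfolding char_def by (subst integral_return) auto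
  have "weak_conv_m D (return borel 0)"
  proof (rule levy_continuity[OF D R])
    fix t :: real
    show "(\<lambda>n. char (D n) t) \<longlonglongrightarrow> char (return borel 0) t"
      unfolding char_R
    proof (rule tendstoI)
      fix e :: real assume e: "e > 0"
      define e' where "e' = e / (2 * (\<bar>t\<bar> + 1))"
      have e': "e' > 0" using e by (auto simp: e'_def)
      have "\<exists>\<eta>>0. \<forall>u. \<bar>u\<bar> \<le> \<eta> \<longrightarrow>
        cmod (char \<mu> u - (\<Sum>k\<le>1. ((\<i> * u) ^ k / fact k) * \<mu>.expectation (\<lambda>x. x ^ k))) \<le> e' * \<bar>u\<bar> ^ 1"
      proof (rule \<mu>.char_taylor_remainder_small)
        fix k :: nat assume "k \<le> 1"
        then consider "k = 0" | "k = 1" by linarith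
        then show "integrable \<mu> (\<lambda>x. x ^ k)" using \<mu>_int by cases auto
      qed (rule e')
      then obtain \<eta> where \<eta>: "\<eta> > 0" and near: "\<And>u. \<bar>u\<bar> \<le> \<eta> \<Longrightarrow> cmod (char \<mu> u - 1) \<le> e' * \<bar>u\<bar>"
        using \<mu>_mean \<mu>.prob_space \<mu>.space_eq_univ by auto
      have "(\<lambda>n. \<bar>t\<bar> / real n) \<longlonglongrightarrow> 0" by (rule lim_const_over_n)
      then have "\<forall>\<^sub>F n in sequentially. \<bar>t\<bar> / real n < \<eta>" using \<eta> by (rule order_tendstoD)
      then show "\<forall>\<^sub>F n in sequentially. dist (char (D n) t) 1 < e"
        using eventually_gt_at_top[of 0]
      proof eventually_elim
        case (elim n)
        have "char (D n) t = char \<mu> (t / real n) ^ n"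
          unfolding D_def using char_weighted_sum_iid[OF indep ident, where n=n and a="\<lambda>_. 1 / real n" and t=t]
          by (simp add: \<mu>_def)
        then have "cmod (char (D n) t - 1) = cmod (char \<mu> (t / real n) ^ n - 1 ^ n)" by simp
        also have "\<dots> \<le> n * cmod (char \<mu> (t / real n) - 1)"
          by (rule norm_power_diff) (auto intro: \<mu>.cmod_char_le_1)
        also have "\<dots> \<le> n * (e' * \<bar>t / real n\<bar>)"
          using elim by (intro mult_left_mono near) auto
        also have "\<dots> = e' * \<bar>t\<bar>" using elim by simp
        also have "\<dots> < e" using e
          by (simp add: e'_def field_simps) (smt (verit) mult_nonneg_nonneg zero_le_mult_iff)
        finally show ?case by (simp add: dist_norm)
      qed
    qed
  qed
  then have conv: "isCont (cdf (return borel 0)) t \<Longrightarrow> (\<lambda>n. cdf (D n) t) \<longlonglongrightarrow> cdf (return borel 0) t" for t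
    by (auto simp: weak_conv_m_def weak_conv_def)
  interpret Rd: real_distribution "return borel (0::real)" by (rule R)
  have cont: "isCont (cdf (return borel 0)) t" if "t \<noteq> 0" for t :: real
    using that by (simp add: Rd.isCont_cdf measure_return)
  have "(\<lambda>n. cdf (D n) (- \<epsilon>)) \<longlonglongrightarrow> cdf (return borel 0) (- \<epsilon>)"
    "(\<lambda>n. cdf (D n) \<epsilon>) \<longlonglongrightarrow> cdf (return borel 0) \<epsilon>"
    using \<epsilon> by (auto intro!: conv cont)
  then have "(\<lambda>n. cdf (D n) (- \<epsilon>)) \<longlonglongrightarrow> 0" "(\<lambda>n. cdf (D n) \<epsilon>) \<longlonglongrightarrow> 1"
    using \<epsilon> by (simp_all add: cdf_def measure_return)
  then have lim: "(\<lambda>n. cdf (D n) (- \<epsilon>) + (1 - cdf (D n) \<epsilon>)) \<longlonglongrightarrow> 0 + (1 - 1)"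
    by (intro tendsto_add tendsto_diff tendsto_const)
  show ?thesis
  proof (rule tendsto_sandwich[OF _ _ tendsto_const lim[simplified]])
    show "\<forall>\<^sub>F n in sequentially. prob {x \<in> space M. \<epsilon> < \<bar>1 / real n * (\<Sum>i=1..n. Y i x)\<bar>}
        \<le> cdf (D n) (- \<epsilon>) + (1 - cdf (D n) \<epsilon>)"
    proof (intro always_eventually allI)
      fix n
      define U where "U x = (\<Sum>i=1..n. 1 / real n * Y i x)" for x
      have [measurable]: "random_variable borel U" unfolding U_def by measurable
      have cdf: "cdf (D n) t = prob {x \<in> space M. U x \<le> t}" for t
        unfolding D_def U_def by (rule cdf_distr_eq_prob) measurable
      have "prob {x \<in> space M. U x > \<epsilon>} = 1 - prob {x \<in> space M. U x \<le> \<epsilon>}"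
        by (subst prob_neg[symmetric]) (auto simp: not_le)
      moreover have "prob {x \<in> space M. \<epsilon> < \<bar>U x\<bar>}
          \<le> prob ({x \<in> space M. U x \<le> - \<epsilon>} \<union> {x \<in> space M. U x > \<epsilon>})"
        by (intro finite_measure_mono) (auto simp: abs_real_def split: if_splits)
      moreover have "\<dots> \<le> prob {x \<in> space M. U x \<le> - \<epsilon>} + prob {x \<in> space M. U x > \<epsilon>}"
        by (intro measure_Un_le) auto
      ultimately show "prob {x \<in> space M. \<epsilon> < \<bar>1 / real n * (\<Sum>i=1..n. Y i x)\<bar>}
        \<le> cdf (D n) (- \<epsilon>) + (1 - cdf (D n) \<epsilon>)"
        unfolding cdf sum_distrib_left U_def[symmetric] by linarith
    qed
  qed auto
qed

lemma abs_minus_one_le_abs_square_minus_one: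
  fixes s :: real
  assumes "s \<ge> 0"
  shows "\<bar>s - 1\<bar> \<le> \<bar>s\<^sup>2 - 1\<bar>"
proof -
  have "\<bar>s - 1\<bar> * 1 \<le> \<bar>s - 1\<bar> * \<bar>s + 1\<bar>" using assms by (intro mult_left_mono) auto
  also have "\<dots> = \<bar>s\<^sup>2 - 1\<bar>" by (simp add: abs_mult[symmetric] algebra_simps power2_eq_square)
  finally show ?thesis by simp
qed

locale centered_iid = prob_space M for M :: "'a measure" +
  fixes X :: "nat \<Rightarrow> 'a \<Rightarrow> real" and \<sigma> :: real
  assumes indep: "indep_vars (\<lambda>i. borel) X {1..}"
    and ident: "\<And>i. i \<ge> 1 \<Longrightarrow> distr M borel (X i) = distr M borel (X 1)"
    and sq_int: "integrable M (\<lambda>x. (X 1 x)\<^sup>2)"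
    and mean: "expectation (X 1) = 0"
    and second_moment: "expectation (\<lambda>x. (X 1 x)\<^sup>2) = \<sigma>\<^sup>2"
    and \<sigma>_pos: "\<sigma> > 0"
begin

lemma rv: "i \<ge> 1 \<Longrightarrow> X i \<in> borel_measurable M"
  using indep unfolding indep_vars_def2 by auto

lemma weighted_sum_rv [measurable]: "(\<lambda>x. \<Sum>i=1..n. a i * X i x) \<in> borel_measurable M"
  by (intro borel_measurable_sum borel_measurable_times borel_measurable_const rv) simp

lemma int1: "integrable M (X 1)"
  by (rule square_integrable_imp_integrable[OF rv sq_int]) simp

lemma prob_X_eq:
  assumes i: "i \<ge> 1" and A: "A \<in> sets borel"
  shows "prob {x \<in> space M. X i x \<in> A} = prob {x \<in> space M. X 1 x \<in> A}"
proof -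
  have "prob {x \<in> space M. X j x \<in> A} = measure (distr M borel (X j)) A" if "j \<ge> 1" for j
    using A rv[OF that] by (subst measure_distr) (auto intro!: arg_cong[where f=prob])
  then show ?thesis using i ident[OF i] by simp
qed

text \<open>
  Both characteristic functions are products over \<open>i\<close> of factors of modulus at most \<open>1\<close>, so
  their distance is at most the sum of the distances of the factors, which is at most a small
  multiple of the sum of the \<open>(a i)\<^sup>2\<close>. The bound \<open>\<eta>\<close> does not depend on \<open>n\<close> or on the
  weights.
\<close>

lemma weighted_sum_char:
  assumes \<epsilon>: "\<epsilon> > 0"
  shows "\<exists>\<eta>>0. \<forall>n a. (\<Sum>i=1..n. (a i)\<^sup>2) = 1 \<and> (\<forall>i\<in>{1..n}. (a i)\<^sup>2 \<le> \<eta>) \<longrightarrow>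
    cmod (char (distr M borel (\<lambda>x. (\<Sum>i=1..n. a i * X i x) / \<sigma>)) t - char std_normal_distribution t) \<le> \<epsilon>"
proof -
  define \<mu> where "\<mu> = distr M borel (X 1)"
  note rv1 [measurable] = rv[OF order_refl]
  interpret \<mu>: real_distribution \<mu>
    unfolding \<mu>_def by (rule real_distribution_distr[OF rv1])
  define s where "s = t / \<sigma>"
  define \<epsilon>' where "\<epsilon>' = \<epsilon> / (s\<^sup>2 + 1)"
  have \<epsilon>': "\<epsilon>' > 0" using \<epsilon> by (auto simp: \<epsilon>'_def intro!: divide_pos_pos add_nonneg_pos)
  have "\<exists>\<eta>>0. \<forall>u. \<bar>u\<bar> \<le> \<eta> \<longrightarrow> cmod (char \<mu> u - complex_of_real (exp (- (\<sigma>\<^sup>2 * u\<^sup>2 / 2)))) \<le> \<epsilon>' * u\<^sup>2"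
    using int1 sq_int mean second_moment
    by (intro char_gaussian_step \<epsilon>' \<mu>.real_distribution_axioms)
      (simp_all add: \<mu>_def integrable_distr_eq integral_distr)
  then obtain \<eta> where \<eta>: "\<eta> > 0" and
    step: "\<And>u. \<bar>u\<bar> \<le> \<eta> \<Longrightarrow> cmod (char \<mu> u - complex_of_real (exp (- (\<sigma>\<^sup>2 * u\<^sup>2 / 2)))) \<le> \<epsilon>' * u\<^sup>2"
    by blast
  \<comment> \<open>Then \<open>(a i)\<^sup>2 \<le> \<eta>'\<close> gives \<open>\<bar>a i * s\<bar> \<le> \<eta>\<close>; the summand \<open>1\<close> covers \<open>s = 0\<close>.\<close>
  define \<eta>' where "\<eta>' = \<eta>\<^sup>2 / (s\<^sup>2 + 1)"
  have "\<eta>' > 0" using \<eta> by (auto simp: \<eta>'_def intro!: divide_pos_pos add_nonneg_pos)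
  moreover have "cmod (char (distr M borel (\<lambda>x. (\<Sum>i=1..n. a i * X i x) / \<sigma>)) t
      - char std_normal_distribution t) \<le> \<epsilon>"
    if a1: "(\<Sum>i=1..n. (a i)\<^sup>2) = 1" and a2: "\<forall>i\<in>{1..n}. (a i)\<^sup>2 \<le> \<eta>'" for n a
  proof -
    have "char (distr M borel (\<lambda>x. (\<Sum>i=1..n. a i * X i x) / \<sigma>)) t
        = char (distr M borel (\<lambda>x. (\<Sum>i=1..n. (a i / \<sigma>) * X i x))) t"
      by (simp add: sum_divide_distrib)
    also have "\<dots> = (\<Prod>i=1..n. char \<mu> (a i * s))"
      by (subst char_weighted_sum_iid[OF indep ident]) (simp_all add: \<mu>_def s_def)
    finally have lhs: "char (distr M borel (\<lambda>x. (\<Sum>i=1..n. a i * X i x) / \<sigma>)) t = \<dots>" .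
    have "- (t\<^sup>2) / 2 = (\<Sum>i=1..n. - (\<sigma>\<^sup>2 * (a i * s)\<^sup>2 / 2))"
    proof -
      have "(\<Sum>i=1..n. - (\<sigma>\<^sup>2 * (a i * s)\<^sup>2 / 2)) = - (\<sigma>\<^sup>2 * s\<^sup>2 / 2) * (\<Sum>i=1..n. (a i)\<^sup>2)"
        by (simp add: sum_distrib_left power_mult_distrib sum_negf mult_ac)
      also have "\<dots> = - (t\<^sup>2) / 2" using \<sigma>_pos a1 by (simp add: s_def power_divide)
      finally show ?thesis by simp
    qed
    then have rhs: "char std_normal_distribution t = (\<Prod>i=1..n. complex_of_real (exp (- (\<sigma>\<^sup>2 * (a i * s)\<^sup>2 / 2))))"
      unfolding char_std_normal_distribution by (simp add: exp_sum)
    have "cmod (char (distr M borel (\<lambda>x. (\<Sum>i=1..n. a i * X i x) / \<sigma>)) t - char std_normal_distribution t)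
        \<le> (\<Sum>i=1..n. cmod (char \<mu> (a i * s) - complex_of_real (exp (- (\<sigma>\<^sup>2 * (a i * s)\<^sup>2 / 2)))))"
      unfolding lhs rhs
      by (rule norm_prod_diff) (auto intro: \<mu>.cmod_char_le_1)
    also have "\<dots> \<le> (\<Sum>i=1..n. \<epsilon>' * (a i * s)\<^sup>2)"
    proof (intro sum_mono step)
      fix i assume i: "i \<in> {1..n}"
      have "(a i * s)\<^sup>2 \<le> \<eta>' * s\<^sup>2" using a2 i by (simp add: power_mult_distrib mult_right_mono)
      also have "\<dots> \<le> \<eta>\<^sup>2 * 1"
        unfolding \<eta>'_def by (simp add: field_simps add_pos_nonneg divide_le_eq)
      finally show "\<bar>a i * s\<bar> \<le> \<eta>" using \<eta> by (simp add: power2_le_iff_abs_le)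
    qed
    also have "\<dots> = \<epsilon>' * s\<^sup>2 * (\<Sum>i=1..n. (a i)\<^sup>2)"
      by (simp add: sum_distrib_left power_mult_distrib mult_ac)
    also have "\<dots> = \<epsilon> * (s\<^sup>2 / (s\<^sup>2 + 1))" using a1 by (simp add: \<epsilon>'_def)
    also have "\<dots> \<le> \<epsilon> * 1" using \<epsilon> by (intro mult_left_mono) (auto simp: divide_le_eq add_nonneg_pos)
    finally show ?thesis by simp
  qed
  ultimately show ?thesis by blast
qed

text \<open>
  Levy's continuity theorem concerns sequences. The uniform bound follows by contradiction:
  weights that violate it for \<open>\<eta> = 1 / (k + 1)\<close>, one choice for each \<open>k\<close>, form a sequence of
  laws whose characteristic functions converge to the Gaussian one while the distribution
  functions at \<open>t\<close> stay away from the limit.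
\<close>

lemma weighted_sum_clt:
  assumes \<delta>: "\<delta> > 0"
  shows "\<exists>\<eta>>0. \<forall>n a. (\<Sum>i=1..n. (a i)\<^sup>2) = 1 \<and> (\<forall>i\<in>{1..n}. (a i)\<^sup>2 \<le> \<eta>) \<longrightarrow>
    \<bar>prob {x \<in> space M. (\<Sum>i=1..n. a i * X i x) / \<sigma> \<le> t} - cdf std_normal_distribution t\<bar> \<le> \<delta>"
proof (rule ccontr)
  let ?S = "\<lambda>n a x. (\<Sum>i=1..n. a i * X i x) / \<sigma>"
  let ?bad = "\<lambda>\<eta> n a. (\<Sum>i=1..n. (a i)\<^sup>2) = 1 \<and> (\<forall>i\<in>{1..n}. (a i)\<^sup>2 \<le> \<eta>) \<and>
    \<not> \<bar>prob {x \<in> space M. ?S n a x \<le> t} - cdf std_normal_distribution t\<bar> \<le> \<delta>"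
  assume "\<not> ?thesis"
  then have "\<forall>\<eta>>0. \<exists>n a. ?bad \<eta> n a" by blast
  then have "\<forall>k. \<exists>n a. ?bad (1 / Suc k) n a" by simp
  then have "\<exists>N. \<forall>k. \<exists>a. ?bad (1 / Suc k) (N k) a" by (rule choice)
  then obtain N where "\<forall>k. \<exists>a. ?bad (1 / Suc k) (N k) a" by blast
  then have "\<exists>A. \<forall>k. ?bad (1 / Suc k) (N k) (A k)" by (rule choice)
  then obtain A where bad: "\<And>k. ?bad (1 / Suc k) (N k) (A k)" by blast
  define D where "D k = distr M borel (?S (N k) (A k))" for k
  have "weak_conv_m D std_normal_distribution"
  proof (rule levy_continuity[OF _ real_dist_normal_dist])
    show "real_distribution (D k)" for k
      unfolding D_def by (rule real_distribution_distr) measurable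
    show "(\<lambda>k. char (D k) u) \<longlonglongrightarrow> char std_normal_distribution u" for u
    proof (rule LIMSEQ_I)
      fix e :: real assume "e > 0"
      then obtain \<eta> where \<eta>: "\<eta> > 0" and near: "\<And>n a. (\<Sum>i=1..n. (a i)\<^sup>2) = 1 \<Longrightarrow> (\<forall>i\<in>{1..n}. (a i)\<^sup>2 \<le> \<eta>) \<Longrightarrow>
        cmod (char (distr M borel (?S n a)) u - char std_normal_distribution u) \<le> e / 2"
        using weighted_sum_char[of "e / 2" u] by auto
      obtain K :: nat where K: "1 / Suc K < \<eta>" using \<eta> nat_approx_posE by blast
      show "\<exists>no. \<forall>k\<ge>no. cmod (char (D k) u - char std_normal_distribution u) < e"
      proof (intro exI[of _ K] allI impI)
        fix k assume "k \<ge> K"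
        then have "1 / Suc k \<le> 1 / Suc K" by (simp add: field_simps)
        then have "\<forall>i\<in>{1..N k}. (A k i)\<^sup>2 \<le> \<eta>" using bad[of k] K by fastforce
        then have "cmod (char (D k) u - char std_normal_distribution u) \<le> e / 2"
          unfolding D_def using bad[of k] by (intro near) auto
        then show "cmod (char (D k) u - char std_normal_distribution u) < e" using \<open>e > 0\<close> by simp
      qed
    qed
  qed
  then have "(\<lambda>k. cdf (D k) t) \<longlonglongrightarrow> cdf std_normal_distribution t"
    using isCont_cdf_std_normal by (auto simp: weak_conv_m_def weak_conv_def)
  then obtain k where "\<bar>cdf (D k) t - cdf std_normal_distribution t\<bar> < \<delta>"
    using \<delta> unfolding LIMSEQ_def dist_real_def by (meson order_refl)
  moreover have "cdf (D k) t = prob {x \<in> space M. ?S (N k) (A k) x \<le> t}"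
    unfolding D_def by (rule cdf_distr_eq_prob) measurable
  ultimately show False using bad[of k] by linarith
qed

section \<open>Studentized sums and negligible summands\<close>

lemma sample_sd_rv [measurable]: "sample_sd X n \<in> borel_measurable M"
proof -
  have "X i \<in> borel_measurable M" if "i \<in> {1..n}" for i using rv that by simp
  note [measurable] = this
  show ?thesis unfolding sample_sd_def sample_mean_def by measurable
qed

lemma sample_sd_eq:
  assumes "n \<ge> 1"
  shows "sample_sd X n x = sqrt (1 / real n * (\<Sum>i=1..n. (X i x)\<^sup>2) - (sample_mean X n x)\<^sup>2)"
proof -
  let ?m = "sample_mean X n x"
  have "(\<Sum>i=1..n. X i x) = n * ?m" using assms by (simp add: sample_mean_def)
  moreover have "(\<Sum>i=1..n. (X i x - ?m)\<^sup>2)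
      = (\<Sum>i=1..n. (X i x)\<^sup>2) - 2 * ?m * (\<Sum>i=1..n. X i x) + n * ?m\<^sup>2"
    by (simp add: power2_diff sum.distrib sum_subtractf sum_distrib_left sum_distrib_right mult_ac)
  ultimately have "(\<Sum>i=1..n. (X i x - ?m)\<^sup>2) = (\<Sum>i=1..n. (X i x)\<^sup>2) - n * ?m\<^sup>2"
    by (simp add: power2_eq_square)
  then show ?thesis
    unfolding sample_sd_def using assms by (simp add: right_diff_distrib)
qed

text \<open>
  By the weak law, the mean of the squares tends to \<open>\<sigma>\<^sup>2\<close> and the sample mean to \<open>0\<close> in
  probability. The estimate \<open>\<bar>s - 1\<bar> \<le> \<bar>s\<^sup>2 - 1\<bar>\<close> for \<open>s \<ge> 0\<close> passes from the variance to the
  standard deviation.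
\<close>

lemma sample_sd_consistent:
  assumes \<epsilon>: "\<epsilon> > 0"
  shows "(\<lambda>n. prob {x \<in> space M. \<bar>sample_sd X n x / \<sigma> - 1\<bar> > \<epsilon>}) \<longlonglongrightarrow> 0"
proof -
  \<comment> \<open>Half of the tolerance for \<open>sample_sd\<^sup>2\<close> goes to the mean of squares, half to the squared mean.\<close>
  define \<kappa> where "\<kappa> = \<epsilon> * \<sigma>\<^sup>2 / 2"
  have \<kappa>: "\<kappa> > 0" using \<epsilon> \<sigma>_pos by (simp add: \<kappa>_def)
  define Q where "Q n x = 1 / real n * (\<Sum>i=1..n. (X i x)\<^sup>2 - \<sigma>\<^sup>2)" for n x
  have rv': "X i \<in> borel_measurable M" if "i \<in> {1..n}" for i n using rv that by simp
  note [measurable] = rv'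
  have Q [measurable]: "Q n \<in> borel_measurable M" for n
    unfolding Q_def
    by (intro borel_measurable_times borel_measurable_sum borel_measurable_diff borel_measurable_power
        borel_measurable_const rv')
  have [measurable]: "sample_mean X n \<in> borel_measurable M" for n
    unfolding sample_mean_def by measurable
  have "(\<lambda>n. prob {x \<in> space M. \<bar>Q n x\<bar> > \<kappa>}) \<longlonglongrightarrow> 0"
    unfolding Q_def
  proof (rule weak_law_of_large_numbers_centered[OF _ _ _ _ \<kappa>])
    show "indep_vars (\<lambda>i. borel) (\<lambda>i x. (X i x)\<^sup>2 - \<sigma>\<^sup>2) {1..}"
      by (rule indep_vars_compose2[OF indep]) auto
    show "integrable M (\<lambda>x. (X 1 x)\<^sup>2 - \<sigma>\<^sup>2)"
      using sq_int by (intro Bochner_Integration.integrable_diff integrable_const)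
    show "expectation (\<lambda>x. (X 1 x)\<^sup>2 - \<sigma>\<^sup>2) = 0"
      using sq_int second_moment by (subst Bochner_Integration.integral_diff) (auto simp: prob_space)
    show "distr M borel (\<lambda>x. (X i x)\<^sup>2 - \<sigma>\<^sup>2) = distr M borel (\<lambda>x. (X 1 x)\<^sup>2 - \<sigma>\<^sup>2)" if i: "i \<ge> 1" for i
    proof -
      have "distr M borel (\<lambda>x. (X j x)\<^sup>2 - \<sigma>\<^sup>2) = distr (distr M borel (X j)) borel (\<lambda>y. y\<^sup>2 - \<sigma>\<^sup>2)"
        if "j \<ge> 1" for j
        using rv[OF that] by (subst distr_distr) (auto simp: comp_def)
      then show ?thesis using i ident[OF i] by simp
    qed
  qed
  moreover have "(\<lambda>n. prob {x \<in> space M. \<bar>sample_mean X n x\<bar> > sqrt \<kappa>}) \<longlonglongrightarrow> 0"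
    unfolding sample_mean_def
    by (rule weak_law_of_large_numbers_centered[OF indep ident int1 mean])
      (use \<kappa> in auto)
  ultimately have lim: "(\<lambda>n. prob {x \<in> space M. \<bar>Q n x\<bar> > \<kappa>} +
      prob {x \<in> space M. \<bar>sample_mean X n x\<bar> > sqrt \<kappa>}) \<longlonglongrightarrow> 0 + 0"
    by (rule tendsto_add)
  show ?thesis
  proof (rule tendsto_sandwich[OF _ _ tendsto_const lim[simplified]])
    show "\<forall>\<^sub>F n in sequentially. prob {x \<in> space M. \<epsilon> < \<bar>sample_sd X n x / \<sigma> - 1\<bar>}
        \<le> prob {x \<in> space M. \<bar>Q n x\<bar> > \<kappa>} + prob {x \<in> space M. \<bar>sample_mean X n x\<bar> > sqrt \<kappa>}"
      using eventually_ge_at_top[of 1]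
    proof eventually_elim
      case (elim n)
      have "\<bar>Q n x\<bar> > \<kappa> \<or> \<bar>sample_mean X n x\<bar> > sqrt \<kappa>" if gt: "\<epsilon> < \<bar>sample_sd X n x / \<sigma> - 1\<bar>" for x
      proof (rule ccontr)
        let ?m = "sample_mean X n x" and ?s = "sample_sd X n x / \<sigma>"
        assume "\<not> ?thesis"
        then have q: "\<bar>Q n x\<bar> \<le> \<kappa>" and m: "\<bar>?m\<bar> \<le> sqrt \<kappa>" by auto
        have "?m\<^sup>2 \<le> (sqrt \<kappa>)\<^sup>2" using m \<kappa> by (intro power2_le_iff_abs_le[THEN iffD2]) auto
        then have m2: "?m\<^sup>2 \<le> \<kappa>" using \<kappa> by simp
        have s0: "?s \<ge> 0" using \<sigma>_pos
          by (auto simp: sample_sd_def intro!: divide_nonneg_nonneg sum_nonneg)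
        have "0 \<le> 1 / real n * (\<Sum>i=1..n. (X i x - ?m)\<^sup>2)"
          by (intro mult_nonneg_nonneg sum_nonneg) auto
        then have "(sample_sd X n x)\<^sup>2 = 1 / real n * (\<Sum>i=1..n. (X i x)\<^sup>2) - ?m\<^sup>2"
          using sample_sd_eq[OF elim, of x] unfolding sample_sd_def by simp
        also have "1 / real n * (\<Sum>i=1..n. (X i x)\<^sup>2) = Q n x + \<sigma>\<^sup>2"
          using elim by (simp add: Q_def sum_subtractf right_diff_distrib diff_divide_distrib)
        finally have "?s\<^sup>2 - 1 = (Q n x - ?m\<^sup>2) / \<sigma>\<^sup>2"
          using \<sigma>_pos by (simp add: power_divide field_simps)
        then have "\<bar>?s\<^sup>2 - 1\<bar> = \<bar>Q n x - ?m\<^sup>2\<bar> / \<sigma>\<^sup>2" by simp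
        also have "\<bar>Q n x - ?m\<^sup>2\<bar> \<le> 2 * \<kappa>" using q m2 zero_le_power2[of ?m] by linarith
        then have "\<bar>Q n x - ?m\<^sup>2\<bar> / \<sigma>\<^sup>2 \<le> (2 * \<kappa>) / \<sigma>\<^sup>2" by (intro divide_right_mono) auto
        also have "\<dots> = \<epsilon>" using \<sigma>_pos by (simp add: \<kappa>_def)
        finally have "\<bar>?s\<^sup>2 - 1\<bar> \<le> \<epsilon>" .
        then show False using abs_minus_one_le_abs_square_minus_one[OF s0] gt by simp
      qed
      then have "prob {x \<in> space M. \<epsilon> < \<bar>sample_sd X n x / \<sigma> - 1\<bar>}
          \<le> prob ({x \<in> space M. \<bar>Q n x\<bar> > \<kappa>} \<union> {x \<in> space M. \<bar>sample_mean X n x\<bar> > sqrt \<kappa>})"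
        by (intro finite_measure_mono) (auto, measurable)
      also have "\<dots> \<le> prob {x \<in> space M. \<bar>Q n x\<bar> > \<kappa>} + prob {x \<in> space M. \<bar>sample_mean X n x\<bar> > sqrt \<kappa>}"
        by (intro measure_Un_le) measurable
      finally show ?case .
    qed
  qed auto
qed

text \<open>
  A uniform form of Slutsky's theorem: outside an event of probability at most \<open>\<eta>\<close>, replacing
  \<open>D\<close> by \<open>\<sigma>\<close> moves the threshold \<open>t\<close> by at most \<open>\<tau>\<close>, and the normal distribution function is
  continuous at \<open>t\<close>.
\<close>

lemma studentized_sum_clt:
  assumes \<delta>: "\<delta> > 0"
  shows "\<exists>\<eta>>0. \<forall>n a D. (\<Sum>i=1..n. (a i)\<^sup>2) = 1 \<and> (\<forall>i\<in>{1..n}. (a i)\<^sup>2 \<le> \<eta>) \<and>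
      D \<in> borel_measurable M \<and> prob {x \<in> space M. \<bar>D x / \<sigma> - 1\<bar> > \<eta>} \<le> \<eta> \<longrightarrow>
    \<bar>prob {x \<in> space M. (\<Sum>i=1..n. a i * X i x) / D x \<le> t} - cdf std_normal_distribution t\<bar> \<le> \<delta>"
proof -
  let ?\<Phi> = "cdf std_normal_distribution"
  obtain r where r: "r > 0" and cont: "\<And>s. \<bar>s - t\<bar> < r \<Longrightarrow> \<bar>?\<Phi> s - ?\<Phi> t\<bar> < \<delta> / 3"
    using isCont_cdf_std_normal[of t, unfolded continuous_at_eps_delta, rule_format, of "\<delta> / 3"] \<delta>
    unfolding dist_real_def by auto
  define \<tau> where "\<tau> = r / 2"
  have \<tau>: "\<tau> > 0" "\<tau> < r" using r by (auto simp: \<tau>_def)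
  have cont_up: "\<bar>?\<Phi> (t + \<tau>) - ?\<Phi> t\<bar> < \<delta> / 3" and cont_lo: "\<bar>?\<Phi> (t - \<tau>) - ?\<Phi> t\<bar> < \<delta> / 3"
    using cont[of "t + \<tau>"] cont[of "t - \<tau>"] \<tau> by auto
  obtain \<eta>1 where \<eta>1: "\<eta>1 > 0" and up: "\<And>n a. (\<Sum>i=1..n. (a i)\<^sup>2) = 1 \<Longrightarrow> (\<forall>i\<in>{1..n}. (a i)\<^sup>2 \<le> \<eta>1) \<Longrightarrow>
    \<bar>prob {x \<in> space M. (\<Sum>i=1..n. a i * X i x) / \<sigma> \<le> t + \<tau>} - ?\<Phi> (t + \<tau>)\<bar> \<le> \<delta> / 3"
    using weighted_sum_clt[of "\<delta> / 3" "t + \<tau>"] \<delta> by auto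
  obtain \<eta>2 where \<eta>2: "\<eta>2 > 0" and lo: "\<And>n a. (\<Sum>i=1..n. (a i)\<^sup>2) = 1 \<Longrightarrow> (\<forall>i\<in>{1..n}. (a i)\<^sup>2 \<le> \<eta>2) \<Longrightarrow>
    \<bar>prob {x \<in> space M. (\<Sum>i=1..n. a i * X i x) / \<sigma> \<le> t - \<tau>} - ?\<Phi> (t - \<tau>)\<bar> \<le> \<delta> / 3"
    using weighted_sum_clt[of "\<delta> / 3" "t - \<tau>"] \<delta> by auto
  have lower_bound: "\<exists>\<eta>>0. \<eta> \<le> a \<and> \<eta> \<le> b \<and> \<eta> \<le> c \<and> \<eta> \<le> d \<and> \<eta> \<le> e"
    if "a > 0" "b > 0" "c > 0" "d > 0" "e > 0" for a b c d e :: real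
    using that by (intro exI[of _ "Min {a, b, c, d, e}"]) (auto simp: min_def)
  have "\<tau> / (\<bar>t\<bar> + 1) > 0" using \<tau> by (simp add: add_nonneg_pos)
  then obtain \<eta> where \<eta>: "\<eta> > 0" "\<eta> \<le> \<eta>1" "\<eta> \<le> \<eta>2" "\<eta> \<le> \<delta> / 3" "\<eta> \<le> 1 / 2" "\<eta> \<le> \<tau> / (\<bar>t\<bar> + 1)"
    using lower_bound[of \<eta>1 \<eta>2 "\<delta> / 3" "1 / 2" "\<tau> / (\<bar>t\<bar> + 1)"] \<eta>1 \<eta>2 \<delta> by auto
  have "\<bar>t\<bar> * \<eta> \<le> (\<bar>t\<bar> + 1) * \<eta>" using \<eta>(1) by simp
  also have "\<dots> \<le> \<tau>" using \<eta>(6) by (simp add: pos_le_divide_eq mult.commute)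
  finally have t\<eta>: "\<bar>t\<bar> * \<eta> \<le> \<tau>" .
  have "\<bar>prob {x \<in> space M. (\<Sum>i=1..n. a i * X i x) / D x \<le> t} - ?\<Phi> t\<bar> \<le> \<delta>"
    if a: "(\<Sum>i=1..n. (a i)\<^sup>2) = 1" "\<forall>i\<in>{1..n}. (a i)\<^sup>2 \<le> \<eta>"
      and D [measurable]: "D \<in> borel_measurable M"
      and bad: "prob {x \<in> space M. \<bar>D x / \<sigma> - 1\<bar> > \<eta>} \<le> \<eta>" for n a D
  proof -
    have weights: "\<forall>i\<in>{1..n}. (a i)\<^sup>2 \<le> \<eta>1" "\<forall>i\<in>{1..n}. (a i)\<^sup>2 \<le> \<eta>2"
      using a(2) \<eta>(2,3) by force+
    define S where "S x = (\<Sum>i=1..n. a i * X i x)" for x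
    have [measurable]: "S \<in> borel_measurable M" unfolding S_def by (rule weighted_sum_rv)
    let ?B = "{x \<in> space M. \<bar>D x / \<sigma> - 1\<bar> > \<eta>}"
    \<comment> \<open>Off the bad event, moving the denominator to the other side shifts \<open>t\<close> by at most \<open>\<tau>\<close>.\<close>
    have good: "D x > 0 \<and> t - \<tau> \<le> t * (D x / \<sigma>) \<and> t * (D x / \<sigma>) \<le> t + \<tau>" if "\<bar>D x / \<sigma> - 1\<bar> \<le> \<eta>" for x
    proof
      have "D x / \<sigma> > 0" using that \<eta>(5) by linarith
      then show "D x > 0" using \<sigma>_pos by (simp add: zero_less_divide_iff)
      have "\<bar>t * (D x / \<sigma>) - t\<bar> = \<bar>t\<bar> * \<bar>D x / \<sigma> - 1\<bar>"
        unfolding abs_mult[symmetric] by (simp add: right_diff_distrib)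
      also have "\<dots> \<le> \<bar>t\<bar> * \<eta>" using that by (intro mult_left_mono) auto
      finally have "\<bar>t * (D x / \<sigma>) - t\<bar> \<le> \<tau>" using t\<eta> by linarith
      then show "t - \<tau> \<le> t * (D x / \<sigma>) \<and> t * (D x / \<sigma>) \<le> t + \<tau>" by (simp only: abs_diff_le_iff)
    qed
    have iff: "S x / D x \<le> t \<longleftrightarrow> S x / \<sigma> \<le> t * (D x / \<sigma>)" if "D x > 0" for x
      using that \<sigma>_pos by (simp add: pos_divide_le_eq)
    have "prob {x \<in> space M. S x / D x \<le> t} \<le> prob ({x \<in> space M. S x / \<sigma> \<le> t + \<tau>} \<union> ?B)"
    proof (intro finite_measure_mono subsetI)
      fix x assume x: "x \<in> {x \<in> space M. S x / D x \<le> t}"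
      show "x \<in> {x \<in> space M. S x / \<sigma> \<le> t + \<tau>} \<union> ?B"
      proof (cases "\<bar>D x / \<sigma> - 1\<bar> \<le> \<eta>")
        case True
        then show ?thesis using good[OF True] iff[of x] x by auto
      qed (use x in auto)
    qed measurable
    also have "\<dots> \<le> prob {x \<in> space M. S x / \<sigma> \<le> t + \<tau>} + prob ?B"
      by (intro measure_Un_le) measurable
    also have "\<dots> \<le> (?\<Phi> (t + \<tau>) + \<delta> / 3) + \<delta> / 3"
      using up[OF a(1) weights(1)] bad \<eta>(4) unfolding S_def by linarith
    also have "\<dots> \<le> ?\<Phi> t + \<delta>" using cont_up by linarith
    finally have upper: "prob {x \<in> space M. S x / D x \<le> t} \<le> ?\<Phi> t + \<delta>" .
    have "?\<Phi> t - \<delta> \<le> ?\<Phi> (t - \<tau>) - \<delta> / 3 - \<delta> / 3" using cont_lo by linarith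
    also have "\<dots> \<le> prob {x \<in> space M. S x / \<sigma> \<le> t - \<tau>} - prob ?B"
      using lo[OF a(1) weights(2)] bad \<eta>(4) unfolding S_def by linarith
    also have "\<dots> \<le> prob {x \<in> space M. S x / D x \<le> t}"
    proof -
      have "prob {x \<in> space M. S x / \<sigma> \<le> t - \<tau>} \<le> prob ({x \<in> space M. S x / D x \<le> t} \<union> ?B)"
      proof (intro finite_measure_mono subsetI)
        fix x assume x: "x \<in> {x \<in> space M. S x / \<sigma> \<le> t - \<tau>}"
        show "x \<in> {x \<in> space M. S x / D x \<le> t} \<union> ?B"
        proof (cases "\<bar>D x / \<sigma> - 1\<bar> \<le> \<eta>")
          case True
          then have "S x / \<sigma> \<le> t * (D x / \<sigma>)"
            using good[OF True] x by (auto intro: order_trans[of _ "t - \<tau>"] simp del: times_divide_eq_right)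
          then show ?thesis using good[OF True] iff[of x] x by simp
        qed (use x in auto)
      qed measurable
      also have "\<dots> \<le> prob {x \<in> space M. S x / D x \<le> t} + prob ?B"
        by (intro measure_Un_le) measurable
      finally show ?thesis by simp
    qed
    finally show ?thesis using upper unfolding S_def by linarith
  qed
  then show ?thesis using \<eta>(1) by blast
qed

text \<open>
  Off the event where \<open>D\<close> is far from \<open>\<sigma>\<close> one has \<open>D \<ge> \<sigma> / 2\<close>, and Chebyshev's inequality
  bounds the probability that \<open>\<bar>b * X i\<bar>\<close> exceeds \<open>\<epsilon> * \<sigma> / 2\<close> by \<open>4 * b\<^sup>2 / \<epsilon>\<^sup>2\<close>.
\<close>

lemma small_weights_imp_negligible:
  assumes \<epsilon>: "\<epsilon> > 0" and \<delta>: "\<delta> > 0"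
  shows "\<exists>\<eta>>0. \<forall>i\<ge>1. \<forall>b D. b\<^sup>2 \<le> \<eta> \<and> D \<in> borel_measurable M \<and>
      prob {x \<in> space M. \<bar>D x / \<sigma> - 1\<bar> > \<eta>} \<le> \<eta> \<longrightarrow>
    prob {x \<in> space M. \<bar>b * X i x\<bar> / D x > \<epsilon>} \<le> \<delta>"
proof -
  define \<eta> where "\<eta> = min (1 / 2) (\<delta> / (4 / \<epsilon>\<^sup>2 + 1))"
  have "\<eta> > 0" unfolding \<eta>_def using \<delta> by (simp add: add_nonneg_pos)
  moreover have "\<eta> \<le> 1 / 2" unfolding \<eta>_def by (rule min.cobounded1)
  ultimately have \<eta>: "\<eta> > 0" "\<eta> \<le> 1 / 2" by auto
  have \<eta>\<delta>0: "\<eta> \<le> \<delta> / (4 / \<epsilon>\<^sup>2 + 1)"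
    unfolding \<eta>_def by (rule min.cobounded2)
  have \<eta>\<delta>: "4 / \<epsilon>\<^sup>2 * \<eta> + \<eta> \<le> \<delta>"
  proof -
    have "0 < 4 / \<epsilon>\<^sup>2 + 1" by (simp add: add_nonneg_pos)
    then have "\<eta> * (4 / \<epsilon>\<^sup>2 + 1) \<le> \<delta>" using \<eta>\<delta>0 by (simp only: pos_le_divide_eq)
    then show ?thesis by (simp add: algebra_simps)
  qed
  have "prob {x \<in> space M. \<bar>b * X i x\<bar> / D x > \<epsilon>} \<le> \<delta>"
    if i: "i \<ge> 1" and b: "b\<^sup>2 \<le> \<eta>" and D [measurable]: "D \<in> borel_measurable M"
      and bad: "prob {x \<in> space M. \<bar>D x / \<sigma> - 1\<bar> > \<eta>} \<le> \<eta>" for i b D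
  proof -
    note [measurable] = rv[OF i] rv[OF order_refl]
    let ?B = "{x \<in> space M. \<bar>D x / \<sigma> - 1\<bar> > \<eta>}"
    let ?A = "{x \<in> space M. \<bar>b * X i x\<bar> > \<epsilon> * (\<sigma> / 2)}"
    have "prob {x \<in> space M. \<bar>b * X i x\<bar> / D x > \<epsilon>} \<le> prob (?A \<union> ?B)"
    proof (intro finite_measure_mono subsetI)
      fix x assume x: "x \<in> {x \<in> space M. \<bar>b * X i x\<bar> / D x > \<epsilon>}"
      show "x \<in> ?A \<union> ?B"
      proof (cases "\<bar>D x / \<sigma> - 1\<bar> \<le> \<eta>")
        case True
        then have "D x / \<sigma> \<ge> 1 / 2" using \<eta>(2) by linarith
        then have D2: "D x \<ge> \<sigma> / 2" using \<sigma>_pos by (simp add: pos_le_divide_eq)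
        then have "D x > 0" using \<sigma>_pos by linarith
        then have "\<epsilon> * D x < \<bar>b * X i x\<bar>" using x by (simp add: pos_less_divide_eq)
        moreover have "\<epsilon> * (\<sigma> / 2) \<le> \<epsilon> * D x" using \<epsilon> D2 by (intro mult_left_mono) auto
        ultimately show ?thesis using x by auto
      qed (use x in auto)
    qed measurable
    also have "\<dots> \<le> prob ?A + prob ?B" by (intro measure_Un_le) measurable
    also have "prob ?A \<le> 4 / \<epsilon>\<^sup>2 * \<eta>"
    proof -
      have "prob ?A = prob {x \<in> space M. X i x \<in> {y. \<bar>b * y\<bar> > \<epsilon> * (\<sigma> / 2)}}" by simp
      also have "\<dots> = prob {x \<in> space M. X 1 x \<in> {y. \<bar>b * y\<bar> > \<epsilon> * (\<sigma> / 2)}}"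
        by (rule prob_X_eq[OF i]) measurable
      also have "\<dots> \<le> prob {x \<in> space M. b\<^sup>2 * (X 1 x)\<^sup>2 \<ge> (\<epsilon> * (\<sigma> / 2))\<^sup>2}"
      proof (intro finite_measure_mono subsetI)
        fix x assume x: "x \<in> {x \<in> space M. X 1 x \<in> {y. \<bar>b * y\<bar> > \<epsilon> * (\<sigma> / 2)}}"
        then have "(\<epsilon> * (\<sigma> / 2))\<^sup>2 \<le> \<bar>b * X 1 x\<bar>\<^sup>2" using \<epsilon> \<sigma>_pos by (intro power_mono) auto
        then show "x \<in> {x \<in> space M. b\<^sup>2 * (X 1 x)\<^sup>2 \<ge> (\<epsilon> * (\<sigma> / 2))\<^sup>2}"
          using x by (simp add: power_mult_distrib)
      qed measurable
      also have "\<dots> \<le> expectation (\<lambda>x. b\<^sup>2 * (X 1 x)\<^sup>2) / (\<epsilon> * (\<sigma> / 2))\<^sup>2"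
        using sq_int \<epsilon> \<sigma>_pos by (intro integral_Markov_inequality_measure[where A="{}"]) auto
      also have "\<dots> = 4 / \<epsilon>\<^sup>2 * b\<^sup>2"
        using second_moment \<sigma>_pos \<epsilon> by (simp add: power_mult_distrib power_divide field_simps)
      also have "\<dots> \<le> 4 / \<epsilon>\<^sup>2 * \<eta>" using b by (intro mult_left_mono) auto
      finally show ?thesis .
    qed
    finally show ?thesis using bad \<eta>\<delta> by linarith
  qed
  then show ?thesis using \<eta>(1) by blast
qed

lemma X_nondegenerate: "\<exists>\<kappa>>0. prob {x \<in> space M. \<bar>X 1 x\<bar> > \<kappa>} > 0"
proof (rule ccontr)
  note [measurable] = rv[OF order_refl]
  assume *: "\<not> ?thesis"
  have "AE x in M. \<not> \<bar>X 1 x\<bar> > 1 / Suc k" for k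
  proof -
    have "1 / real (Suc k) > 0" by simp
    then have "\<not> prob {x \<in> space M. \<bar>X 1 x\<bar> > 1 / Suc k} > 0" using * by blast
    then have "prob {x \<in> space M. \<bar>X 1 x\<bar> > 1 / Suc k} = 0" by (simp add: zero_less_measure_iff)
    moreover have "{x \<in> space M. \<bar>X 1 x\<bar> > 1 / Suc k} \<in> events" by measurable
    ultimately show ?thesis using prob_eq_0 by auto
  qed
  then have "AE x in M. \<forall>k. \<not> \<bar>X 1 x\<bar> > 1 / Suc k" by (simp add: AE_all_countable)
  then have "AE x in M. (X 1 x)\<^sup>2 = 0"
  proof eventually_elim
    case (elim x)
    have "\<not> \<bar>X 1 x\<bar> > 0" using elim by (meson nat_approx_posE)
    then show ?case by simp
  qed
  then have "expectation (\<lambda>x. (X 1 x)\<^sup>2) = 0" by (rule integral_eq_zero_AE)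
  then show False using second_moment \<sigma>_pos by simp
qed

text \<open>
  Since \<open>X 1\<close> has positive variance, \<open>\<bar>X i\<bar> > \<kappa>\<close> has a fixed probability \<open>q > 0\<close> for some
  \<open>\<kappa> > 0\<close>. If \<open>b\<^sup>2 > \<delta>\<close>, this event and \<open>0 < D < 2 * \<sigma>\<close> force \<open>\<bar>b * X i\<bar> / D > \<epsilon>\<close> for
  \<open>\<epsilon> = sqrt \<delta> * \<kappa> / (2 * \<sigma>)\<close>. The probabilities of a large summand and of a bad denominator
  then add up to at least \<open>q\<close>, so they cannot both be below \<open>q / 2\<close>.
\<close>

lemma negligible_imp_small_weights:
  assumes \<delta>: "\<delta> > 0"
  shows "\<exists>\<epsilon>>0. \<exists>\<eta>>0. \<forall>i\<ge>1. \<forall>b D. D \<in> borel_measurable M \<and>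
      prob {x \<in> space M. \<bar>D x / \<sigma> - 1\<bar> > \<eta>} \<le> \<eta> \<and>
      prob {x \<in> space M. \<bar>b * X i x\<bar> / D x > \<epsilon>} \<le> \<eta> \<longrightarrow> b\<^sup>2 \<le> \<delta>"
proof -
  obtain \<kappa> where \<kappa>: "\<kappa> > 0" and p: "prob {x \<in> space M. \<bar>X 1 x\<bar> > \<kappa>} > 0"
    using X_nondegenerate by blast
  define q where "q = prob {x \<in> space M. \<bar>X 1 x\<bar> > \<kappa>}"
  have q: "q > 0" using p by (simp only: q_def)
  define \<epsilon> where "\<epsilon> = sqrt \<delta> * \<kappa> / (2 * \<sigma>)"
  have \<epsilon>: "\<epsilon> > 0" using \<delta> \<kappa> \<sigma>_pos by (simp add: \<epsilon>_def)
  define \<eta> where "\<eta> = min (1 / 2) (q / 3)"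
  have \<eta>: "\<eta> > 0" "\<eta> \<le> 1 / 2" "2 * \<eta> < q" using q by (auto simp: \<eta>_def min_def)
  have "b\<^sup>2 \<le> \<delta>"
    if i: "i \<ge> 1" and D [measurable]: "D \<in> borel_measurable M"
      and bad: "prob {x \<in> space M. \<bar>D x / \<sigma> - 1\<bar> > \<eta>} \<le> \<eta>"
      and negl: "prob {x \<in> space M. \<bar>b * X i x\<bar> / D x > \<epsilon>} \<le> \<eta>" for i b D
  proof (rule ccontr)
    note [measurable] = rv[OF i]
    assume "\<not> b\<^sup>2 \<le> \<delta>"
    then have "sqrt \<delta> < sqrt (b\<^sup>2)" by (intro real_sqrt_less_mono) simp
    then have b: "\<bar>b\<bar> > sqrt \<delta>" by simp
    let ?B = "{x \<in> space M. \<bar>D x / \<sigma> - 1\<bar> > \<eta>}"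
    let ?A = "{x \<in> space M. \<bar>b * X i x\<bar> / D x > \<epsilon>}"
    have "q = prob {x \<in> space M. X i x \<in> {y. \<bar>y\<bar> > \<kappa>}}"
      unfolding q_def by (subst prob_X_eq[OF i]) auto
    also have "\<dots> \<le> prob (?A \<union> ?B)"
    proof (intro finite_measure_mono subsetI)
      fix x assume x: "x \<in> {x \<in> space M. X i x \<in> {y. \<bar>y\<bar> > \<kappa>}}"
      show "x \<in> ?A \<union> ?B"
      proof (cases "\<bar>D x / \<sigma> - 1\<bar> \<le> \<eta>")
        case True
        then have "1 / 2 \<le> D x / \<sigma>" "D x / \<sigma> < 2" using \<eta>(2) by linarith+
        then have D: "D x \<ge> \<sigma> / 2" "D x < 2 * \<sigma>"
          using \<sigma>_pos by (simp_all add: pos_le_divide_eq pos_divide_less_eq)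
        then have D0: "D x > 0" using \<sigma>_pos by linarith
        have "\<epsilon> * D x \<le> \<epsilon> * (2 * \<sigma>)" using D \<epsilon> by (intro mult_left_mono) auto
        also have "\<dots> = sqrt \<delta> * \<kappa>" using \<sigma>_pos by (simp add: \<epsilon>_def)
        also have "\<dots> < \<bar>b\<bar> * \<bar>X i x\<bar>" using b x \<kappa> \<delta> by (intro mult_strict_mono) auto
        finally show ?thesis using x D0 by (simp add: pos_less_divide_eq abs_mult)
      qed (use x in auto)
    qed measurable
    also have "\<dots> \<le> prob ?A + prob ?B" by (intro measure_Un_le) measurable
    finally show False using bad negl \<eta>(3) by linarith
  qed
  then show ?thesis using \<epsilon> \<eta>(1) by blast
qed

end

section \<open>Conditional probability given the weights\<close>

text \<open>
  The \<open>\<sigma>\<close>-algebra generated by the weights on \<open>Pv\<close> itself; \<open>sigma_weights\<close> is its pullback to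
  the product space. Measurability on \<open>PX \<Otimes>\<^sub>M weight_algebra Pv v n\<close> expresses that an event
  involves the second coordinate only through \<open>v n 1, \<dots>, v n n\<close>. The underlying measure of the
  algebra is the zero measure.
\<close>

definition weight_algebra :: "'b measure \<Rightarrow> (nat \<Rightarrow> nat \<Rightarrow> 'b \<Rightarrow> real) \<Rightarrow> nat \<Rightarrow> 'b measure" where
  "weight_algebra Pv v n = sigma (space Pv) (\<Union>i\<in>{1..n}. {v n i -` B \<inter> space Pv | B. B \<in> sets borel})"

lemma space_weight_algebra [simp]: "space (weight_algebra Pv v n) = space Pv"
  unfolding weight_algebra_def by (subst space_measure_of) auto

lemma weight_measurable:
  assumes "i \<in> {1..n}"
  shows "v n i \<in> borel_measurable (weight_algebra Pv v n)"
proof (rule measurableI)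
  let ?G = "\<Union>i\<in>{1..n}. {v n i -` B \<inter> space Pv | B. B \<in> sets borel}"
  have sets: "sets (weight_algebra Pv v n) = sigma_sets (space Pv) ?G"
    unfolding weight_algebra_def by (rule sets_measure_of) auto
  show "v n i -` B \<inter> space (weight_algebra Pv v n) \<in> sets (weight_algebra Pv v n)"
    if "B \<in> sets borel" for B
    unfolding space_weight_algebra sets using assms that by (intro sigma_sets.Basic) blast
qed auto

lemma weight_algebra_sets_subset:
  assumes "\<And>i. i \<in> {1..n} \<Longrightarrow> v n i \<in> borel_measurable Pv"
  shows "sets (weight_algebra Pv v n) \<subseteq> sets Pv"
  unfolding weight_algebra_def using assms
  by (subst sets_measure_of) (auto intro!: sets.sigma_sets_subset measurable_sets)

lemma finite_measure_weight_algebra: "finite_measure (weight_algebra Pv v n)"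
  by (rule finite_measureI) (simp add: weight_algebra_def emeasure_sigma)

lemma snd_measurable_weight_algebra:
  "snd \<in> measurable (sigma_weights PX Pv v n) (weight_algebra Pv v n)"
proof -
  have sp: "space (sigma_weights PX Pv v n) = space (PX \<Otimes>\<^sub>M Pv)"
    unfolding sigma_weights_def by (subst space_measure_of) auto
  have sets: "sets (sigma_weights PX Pv v n) = sigma_sets (space (PX \<Otimes>\<^sub>M Pv))
     (\<Union>i\<in>{1..n}. {(\<lambda>z. v n i (snd z)) -` B \<inter> space (PX \<Otimes>\<^sub>M Pv) | B. B \<in> sets borel})"
    unfolding sigma_weights_def by (rule sets_measure_of) auto
  show ?thesis
    unfolding weight_algebra_def
  proof (rule measurable_measure_of)
    show "snd \<in> space (sigma_weights PX Pv v n) \<rightarrow> space Pv"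
      unfolding sp by (auto simp: space_pair_measure)
    fix A assume "A \<in> (\<Union>i\<in>{1..n}. {v n i -` B \<inter> space Pv | B. B \<in> sets borel})"
    then obtain i B where i: "i \<in> {1..n}" and B: "B \<in> sets borel" and A: "A = v n i -` B \<inter> space Pv"
      by auto
    have "snd -` A \<inter> space (sigma_weights PX Pv v n) = (\<lambda>z. v n i (snd z)) -` B \<inter> space (PX \<Otimes>\<^sub>M Pv)"
      unfolding sp A by (auto simp: space_pair_measure)
    also have "\<dots> \<in> sets (sigma_weights PX Pv v n)"
      unfolding sets using i B by (intro sigma_sets.Basic) blast
    finally show "snd -` A \<inter> space (sigma_weights PX Pv v n) \<in> sets (sigma_weights PX Pv v n)" .
  qed auto
qed

lemma sigma_weights_subalgebra:
  assumes "\<And>i. i \<in> {1..n} \<Longrightarrow> v n i \<in> borel_measurable Pv"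
  shows "subalgebra (PX \<Otimes>\<^sub>M Pv) (sigma_weights PX Pv v n)"
proof -
  have "(\<lambda>z. v n i (snd z)) \<in> borel_measurable (PX \<Otimes>\<^sub>M Pv)" if "i \<in> {1..n}" for i
    using assms[OF that] by measurable
  then have "sigma_sets (space (PX \<Otimes>\<^sub>M Pv))
     (\<Union>i\<in>{1..n}. {(\<lambda>z. v n i (snd z)) -` B \<inter> space (PX \<Otimes>\<^sub>M Pv) | B. B \<in> sets borel})
     \<subseteq> sets (PX \<Otimes>\<^sub>M Pv)"
    by (intro sets.sigma_sets_subset) (auto intro: measurable_sets)
  moreover have "space (sigma_weights PX Pv v n) = space (PX \<Otimes>\<^sub>M Pv)"
    unfolding sigma_weights_def by (subst space_measure_of) auto
  moreover have "sets (sigma_weights PX Pv v n) = sigma_sets (space (PX \<Otimes>\<^sub>M Pv))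
     (\<Union>i\<in>{1..n}. {(\<lambda>z. v n i (snd z)) -` B \<inter> space (PX \<Otimes>\<^sub>M Pv) | B. B \<in> sets borel})"
    unfolding sigma_weights_def by (rule sets_measure_of) auto
  ultimately show ?thesis unfolding subalgebra_def by simp
qed

lemma P_X_given_v_measurable [measurable]:
  assumes "prob_space PX"
  shows "P_X_given_v PX Pv v n Q \<in> borel_measurable Pv"
proof -
  obtain x where x: "x \<in> space PX" using prob_space.not_empty[OF assms] by blast
  let ?f = "real_cond_exp (PX \<Otimes>\<^sub>M Pv) (sigma_weights PX Pv v n)
      (indicator {z \<in> space (PX \<Otimes>\<^sub>M Pv). Q (fst z) (snd z)})"
  have "(\<lambda>w. ?f (x, w)) \<in> borel_measurable Pv"
    by (rule measurable_Pair2[OF borel_measurable_cond_exp2 x])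
  then show ?thesis
    by (subst measurable_cong[OF P_X_given_v_eq[OF x]])
qed

text \<open>
  The section probability \<open>h\<close> is a function of the weights by the assumption on \<open>Q\<close>, and
  integrals over a set \<open>A\<close> of \<open>sigma_weights\<close> agree by Fubini because \<open>A\<close> is a cylinder over
  \<open>Pv\<close>. These two properties characterize the conditional expectation up to null sets of the
  product; a null set of the product has a null section at some data point \<open>x\<close>, and the
  conditional expectation does not depend on \<open>x\<close>.
\<close>

lemma P_X_given_v_eq_section_prob:
  assumes PX: "prob_space PX" and Pv: "prob_space Pv"
    and v_meas: "\<And>i. i \<in> {1..n} \<Longrightarrow> v n i \<in> borel_measurable Pv"
    and Q: "{z \<in> space (PX \<Otimes>\<^sub>M Pv). Q (fst z) (snd z)} \<in> sets (PX \<Otimes>\<^sub>M weight_algebra Pv v n)"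
  shows "AE w in Pv. P_X_given_v PX Pv v n Q w = measure PX {x \<in> space PX. Q x w}"
proof -
  interpret PX: prob_space PX by fact
  interpret Pv: prob_space Pv by fact
  interpret PP: pair_prob_space PX Pv ..
  let ?P = "PX \<Otimes>\<^sub>M Pv" and ?F = "sigma_weights PX Pv v n" and ?W = "weight_algebra Pv v n"
  interpret W: finite_measure ?W by (rule finite_measure_weight_algebra)
  interpret PW: pair_sigma_finite PX ?W ..
  have sub: "subalgebra ?P ?F" by (rule sigma_weights_subalgebra) (rule v_meas)
  interpret F: finite_measure_subalgebra ?P ?F
    by unfold_locales (rule sub)
  define E where "E = {z \<in> space ?P. Q (fst z) (snd z)}"
  have "sets (PX \<Otimes>\<^sub>M ?W) \<subseteq> sets ?P"
    unfolding sets_pair_measure space_weight_algebra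
    using weight_algebra_sets_subset[of n v Pv, OF v_meas] by (intro sigma_sets_mono') blast
  then have E [measurable]: "E \<in> sets ?P" using Q unfolding E_def by blast
  define h where "h w = measure PX {x \<in> space PX. Q x w}" for w
  have sect: "(\<lambda>x. (x, w)) -` E = {x \<in> space PX. Q x w}" if "w \<in> space Pv" for w
    using that by (auto simp: E_def space_pair_measure)
  have "(\<lambda>w. enn2real (emeasure PX ((\<lambda>x. (x, w)) -` E))) \<in> borel_measurable ?W"
    using PW.measurable_emeasure_Pair2[OF Q] unfolding E_def by measurable
  also have "?this \<longleftrightarrow> h \<in> borel_measurable ?W"
    by (intro measurable_cong) (simp add: h_def sect measure_def)
  finally have h: "h \<in> borel_measurable ?W" .
  have hF: "(\<lambda>z. h (snd z)) \<in> borel_measurable ?F"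
    by (rule measurable_compose[OF snd_measurable_weight_algebra h])
  have hP [measurable]: "(\<lambda>z. h (snd z)) \<in> borel_measurable ?P"
    by (rule measurable_from_subalg[OF sub hF])
  have h_int: "integrable ?P (\<lambda>z. h (snd z))"
    by (rule PP.integrable_const_bound[OF _ hP, of 1]) (simp add: h_def)
  have "AE z in ?P. real_cond_exp ?P ?F (indicator E) z = h (snd z)"
  proof (rule F.real_cond_exp_charact[OF _ _ h_int hF])
    show "integrable ?P (indicator E :: _ \<Rightarrow> real)"
      by (rule PP.integrable_const_bound[of _ 1]) auto
    fix A assume A: "A \<in> sets ?F"
    then have AP [measurable]: "A \<in> sets ?P" using sub by (auto simp: subalgebra_def)
    \<comment> \<open>\<open>A\<close> does not depend on the data, so its indicator leaves the inner integral.\<close>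
    obtain x0 where x0: "x0 \<in> space PX" using PX.not_empty by blast
    have fibre: "indicat_real A (x, w) = indicat_real A (x0, w)" if "x \<in> space PX" "w \<in> space Pv" for x w
      using sigma_weights_fibre[OF A that(1) x0 that(2)] by (simp add: indicator_def)
    have int1: "integrable ?P (\<lambda>(x, w). indicat_real A (x, w) * indicat_real E (x, w))"
      by (rule PP.integrable_const_bound[of _ 1]) (auto simp: indicator_def)
    have int2: "integrable ?P (\<lambda>(x, w). indicat_real A (x, w) * h w)"
    proof (rule PP.integrable_const_bound[of _ 1])
      show "(\<lambda>(x, w). indicat_real A (x, w) * h w) \<in> borel_measurable ?P"
        unfolding split_beta by measurable
    qed (auto simp: indicator_def h_def)
    have "(\<integral>z\<in>A. indicator E z \<partial>?P) = (\<integral>w. (\<integral>x. indicat_real A (x, w) * indicat_real E (x, w) \<partial>PX) \<partial>Pv)"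
      using PP.integral_snd[OF int1] by (simp add: set_lebesgue_integral_def case_prod_unfold)
    also have "\<dots> = (\<integral>w. (\<integral>x. indicat_real A (x, w) * h w \<partial>PX) \<partial>Pv)"
    proof (rule Bochner_Integration.integral_cong[OF refl])
      fix w assume w: "w \<in> space Pv"
      have "(\<integral>x. indicat_real A (x, w) * indicat_real E (x, w) \<partial>PX)
          = (\<integral>x. indicat_real A (x0, w) * indicat_real {x \<in> space PX. Q x w} x \<partial>PX)"
        using fibre[OF _ w] sect[OF w]
        by (intro Bochner_Integration.integral_cong[OF refl]) (auto simp: indicator_def vimage_def)
      also have "\<dots> = indicat_real A (x0, w) * h w"
        by (simp add: h_def Int_absorb2 Collect_restrict)
      also have "\<dots> = (\<integral>x. indicat_real A (x, w) * h w \<partial>PX)"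
        using fibre[OF _ w] by (subst Bochner_Integration.integral_cong[OF refl, where g="\<lambda>x. indicat_real A (x0, w) * h w"])
          (auto simp: PX.prob_space)
      finally show "(\<integral>x. indicat_real A (x, w) * indicat_real E (x, w) \<partial>PX)
        = (\<integral>x. indicat_real A (x, w) * h w \<partial>PX)" .
    qed
    also have "\<dots> = (\<integral>z\<in>A. h (snd z) \<partial>?P)"
      using PP.integral_snd[OF int2] by (simp add: set_lebesgue_integral_def case_prod_unfold)
    finally show "(\<integral>z\<in>A. indicator E z \<partial>?P) = (\<integral>z\<in>A. h (snd z) \<partial>?P)" .
  qed
  then have AE: "AE x in PX. AE w in Pv. real_cond_exp ?P ?F (indicator E) (x, w) = h w"
    using PP.AE_pair by fastforce
  have "\<exists>x\<in>space PX. AE w in Pv. real_cond_exp ?P ?F (indicator E) (x, w) = h w"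
  proof (rule ccontr)
    assume "\<not> ?thesis"
    then have "AE x in PX. False" using AE by (auto elim!: AE_mp intro!: AE_I2)
    then show False by simp
  qed
  then obtain x where x: "x \<in> space PX"
    and *: "AE w in Pv. real_cond_exp ?P ?F (indicator E) (x, w) = h w" by blast
  from * AE_space show ?thesis
  proof eventually_elim
    case (elim w)
    then show ?case using P_X_given_v_eq[OF x, of w Pv v n Q] by (simp add: E_def h_def)
  qed
qed

section \<open>Almost sure limits and limits in probability\<close>

text \<open>
  What the two modes of convergence have in common: convergent deterministic sequences converge, and
  \<open>Y\<close> converges to \<open>c\<close> if for every \<open>\<delta>\<close> the closeness of \<open>Y n\<close> to \<open>c\<close> is forced, for almost every single \<open>w\<close>, by the
  smallness of two null sequences. The null sequences and the threshold \<open>\<eta>\<close> may depend on \<open>\<delta>\<close>.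
  In the application one of them measures the weights and the other the error of the denominator.
  The condition \<open>n \<ge> 2\<close> is there because for \<open>n = 1\<close> the only centered weight is \<open>0\<close>.
\<close>

locale limit_mode =
  fixes Pv :: "'b measure" and Lim :: "(nat \<Rightarrow> 'b \<Rightarrow> real) \<Rightarrow> real \<Rightarrow> bool"
  assumes deterministic: "\<And>c l. c \<longlonglongrightarrow> l \<Longrightarrow> Lim (\<lambda>n w. c n) l"
    and transfer: "\<And>Y c.
      (\<And>\<delta>. \<delta> > 0 \<Longrightarrow> \<exists>A B \<eta>. \<eta> > 0 \<and> Lim A 0 \<and> Lim B 0 \<and>
        (\<forall>n\<ge>2. A n \<in> borel_measurable Pv \<and> B n \<in> borel_measurable Pv \<and>
          (AE w in Pv. \<bar>A n w\<bar> \<le> \<eta> \<and> \<bar>B n w\<bar> \<le> \<eta> \<longrightarrow> \<bar>Y n w - c\<bar> \<le> \<delta>))) \<Longrightarrow> Lim Y c"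

text \<open>
  The premise of \<open>limit_mode.transfer\<close> in the form of a rule.
\<close>

lemma control_by_null_sequences:
  fixes Lim :: "(nat \<Rightarrow> 'b \<Rightarrow> real) \<Rightarrow> real \<Rightarrow> bool" and \<delta> :: real
  assumes "\<eta> > 0" "Lim A 0" "Lim B 0"
    and "\<And>n. n \<ge> 2 \<Longrightarrow> A n \<in> borel_measurable Pv" "\<And>n. n \<ge> 2 \<Longrightarrow> B n \<in> borel_measurable Pv"
    and "\<And>n. n \<ge> 2 \<Longrightarrow> AE w in Pv. \<bar>A n w\<bar> \<le> \<eta> \<and> \<bar>B n w\<bar> \<le> \<eta> \<longrightarrow> \<bar>Y n w - c\<bar> \<le> \<delta>"
  shows "\<exists>A B \<eta>. \<eta> > 0 \<and> Lim A 0 \<and> Lim B 0 \<and>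
    (\<forall>n\<ge>2. A n \<in> borel_measurable Pv \<and> B n \<in> borel_measurable Pv \<and>
      (AE w in Pv. \<bar>A n w\<bar> \<le> \<eta> \<and> \<bar>B n w\<bar> \<le> \<eta> \<longrightarrow> \<bar>Y n w - c\<bar> \<le> \<delta>))"
  by (intro exI[of _ A] exI[of _ B] exI[of _ \<eta>] conjI allI impI assms)

text \<open>
  Testing \<open>\<delta> = 1 / (k + 1)\<close> is enough, so only countably many null sets of \<open>w\<close> are discarded.
\<close>

lemma limit_mode_as: "limit_mode Pv (tendsto_as Pv)"
proof
  show "tendsto_as Pv (\<lambda>n w. c n) l" if "c \<longlonglongrightarrow> l" for c l
    using that by (simp add: tendsto_as_def)
  fix Y and c :: real
  assume hyp: "\<And>\<delta>. \<delta> > 0 \<Longrightarrow> \<exists>A B \<eta>. \<eta> > 0 \<and> tendsto_as Pv A 0 \<and> tendsto_as Pv B 0 \<and>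
        (\<forall>n\<ge>2. A n \<in> borel_measurable Pv \<and> B n \<in> borel_measurable Pv \<and>
          (AE w in Pv. \<bar>A n w\<bar> \<le> \<eta> \<and> \<bar>B n w\<bar> \<le> \<eta> \<longrightarrow> \<bar>Y n w - c\<bar> \<le> \<delta>))"
  have "AE w in Pv. \<forall>\<^sub>F n in sequentially. \<bar>Y n w - c\<bar> \<le> 1 / Suc k" for k
  proof -
    have "1 / real (Suc k) > 0" by simp
    from hyp[OF this] obtain A B \<eta> where \<eta>: "\<eta> > 0" and A: "tendsto_as Pv A 0" and B: "tendsto_as Pv B 0"
      and imp: "\<forall>n\<ge>2. AE w in Pv. \<bar>A n w\<bar> \<le> \<eta> \<and> \<bar>B n w\<bar> \<le> \<eta> \<longrightarrow> \<bar>Y n w - c\<bar> \<le> 1 / Suc k"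
      by blast
    have "AE w in Pv. \<forall>n. n \<ge> 2 \<longrightarrow> \<bar>A n w\<bar> \<le> \<eta> \<and> \<bar>B n w\<bar> \<le> \<eta> \<longrightarrow> \<bar>Y n w - c\<bar> \<le> 1 / Suc k"
      unfolding AE_all_countable using imp by auto
    then show ?thesis
      using A[unfolded tendsto_as_def] B[unfolded tendsto_as_def]
    proof eventually_elim
      case (elim w)
      note imp_w = elim(1)
      from tendstoD[OF elim(2) \<eta>] tendstoD[OF elim(3) \<eta>] eventually_ge_at_top[of 2]
      show ?case
      proof eventually_elim
        case (elim n)
        then show ?case using imp_w by (auto simp: dist_real_def)
      qed
    qed
  qed
  then have "AE w in Pv. \<forall>k. \<forall>\<^sub>F n in sequentially. \<bar>Y n w - c\<bar> \<le> 1 / Suc k"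
    unfolding AE_all_countable by blast
  then show "tendsto_as Pv Y c"
    unfolding tendsto_as_def
  proof eventually_elim
    case (elim w)
    show ?case
    proof (rule tendstoI)
      fix e :: real assume "e > 0"
      then obtain k where "1 / Suc k < e" using nat_approx_posE by blast
      then show "\<forall>\<^sub>F n in sequentially. dist (Y n w) c < e"
        using elim[rule_format, of k] by (auto simp: dist_real_def elim!: eventually_mono)
    qed
  qed
qed

text \<open>
  The event \<open>\<bar>Y n - c\<bar> > \<delta>\<close> is almost surely contained in the union of \<open>\<bar>A n\<bar> > \<eta>\<close> and
  \<open>\<bar>B n\<bar> > \<eta>\<close>, whose probability tends to \<open>0\<close>.
\<close>

lemma limit_mode_in_prob:
  assumes "prob_space Pv"
  shows "limit_mode Pv (tendsto_in_prob Pv)"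
proof
  interpret prob_space Pv by fact
  show "tendsto_in_prob Pv (\<lambda>n w. c n) l" if c: "c \<longlonglongrightarrow> l" for c l
    unfolding tendsto_in_prob_def
  proof (intro allI impI tendsto_eventually)
    fix \<delta> :: real assume "\<delta> > 0"
    from tendstoD[OF c this]
    show "\<forall>\<^sub>F n in sequentially. prob {w \<in> space Pv. \<delta> < \<bar>c n - l\<bar>} = 0"
      by eventually_elim (simp add: dist_real_def)
  qed
  fix Y and c :: real
  assume hyp: "\<And>\<delta>. \<delta> > 0 \<Longrightarrow> \<exists>A B \<eta>. \<eta> > 0 \<and> tendsto_in_prob Pv A 0 \<and> tendsto_in_prob Pv B 0 \<and>
        (\<forall>n\<ge>2. A n \<in> borel_measurable Pv \<and> B n \<in> borel_measurable Pv \<and>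
          (AE w in Pv. \<bar>A n w\<bar> \<le> \<eta> \<and> \<bar>B n w\<bar> \<le> \<eta> \<longrightarrow> \<bar>Y n w - c\<bar> \<le> \<delta>))"
  show "tendsto_in_prob Pv Y c"
    unfolding tendsto_in_prob_def
  proof (intro allI impI)
    fix \<delta> :: real assume "\<delta> > 0"
    from hyp[OF this] obtain A B \<eta> where \<eta>: "\<eta> > 0"
      and A: "tendsto_in_prob Pv A 0" and B: "tendsto_in_prob Pv B 0"
      and imp: "\<And>n. n \<ge> 2 \<Longrightarrow> A n \<in> borel_measurable Pv \<and> B n \<in> borel_measurable Pv \<and>
        (AE w in Pv. \<bar>A n w\<bar> \<le> \<eta> \<and> \<bar>B n w\<bar> \<le> \<eta> \<longrightarrow> \<bar>Y n w - c\<bar> \<le> \<delta>)"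
      by blast
    have lim: "(\<lambda>n. prob {w \<in> space Pv. \<bar>A n w\<bar> > \<eta>} + prob {w \<in> space Pv. \<bar>B n w\<bar> > \<eta>}) \<longlonglongrightarrow> 0 + 0"
      using A B \<eta> unfolding tendsto_in_prob_def by (intro tendsto_add) auto
    show "(\<lambda>n. prob {w \<in> space Pv. \<delta> < \<bar>Y n w - c\<bar>}) \<longlonglongrightarrow> 0"
    proof (rule tendsto_sandwich[OF _ _ tendsto_const lim[simplified]])
      show "\<forall>\<^sub>F n in sequentially. prob {w \<in> space Pv. \<delta> < \<bar>Y n w - c\<bar>}
        \<le> prob {w \<in> space Pv. \<bar>A n w\<bar> > \<eta>} + prob {w \<in> space Pv. \<bar>B n w\<bar> > \<eta>}"
        using eventually_ge_at_top[of 2]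
      proof eventually_elim
        case (elim n)
        note i = imp[OF elim]
        from i have [measurable]: "A n \<in> borel_measurable Pv" "B n \<in> borel_measurable Pv" by auto
        from i have "AE w in Pv. \<bar>A n w\<bar> \<le> \<eta> \<and> \<bar>B n w\<bar> \<le> \<eta> \<longrightarrow> \<bar>Y n w - c\<bar> \<le> \<delta>" by blast
        then have "AE w in Pv. w \<in> {w \<in> space Pv. \<delta> < \<bar>Y n w - c\<bar>} \<longrightarrow>
            w \<in> {w \<in> space Pv. \<bar>A n w\<bar> > \<eta>} \<union> {w \<in> space Pv. \<bar>B n w\<bar> > \<eta>}"
          by eventually_elim auto
        then have "prob {w \<in> space Pv. \<delta> < \<bar>Y n w - c\<bar>}
            \<le> prob ({w \<in> space Pv. \<bar>A n w\<bar> > \<eta>} \<union> {w \<in> space Pv. \<bar>B n w\<bar> > \<eta>})"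
          by (rule finite_measure_mono_AE) measurable
        also have "\<dots> \<le> prob {w \<in> space Pv. \<bar>A n w\<bar> > \<eta>} + prob {w \<in> space Pv. \<bar>B n w\<bar> > \<eta>}"
          by (intro measure_Un_le) measurable
        finally show ?case .
      qed
    qed auto
  qed
qed

section \<open>Negligible weights and the conditional central limit theorem\<close>

lemma V_norm_square: "(V_norm v n w)\<^sup>2 = (\<Sum>i=1..n. (cwt v n i w)\<^sup>2)"
  by (simp add: V_norm_def sum_nonneg)

lemma normalized_cwt_square_sum:
  assumes "V_norm v n w > 0"
  shows "(\<Sum>i=1..n. (cwt v n i w / V_norm v n w)\<^sup>2) = 1"
  using assms by (simp add: power_divide sum_divide_distrib[symmetric] V_norm_square[symmetric] del: One_nat_def)

lemma M_ratio_le_iff: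
  assumes "n \<ge> 1" and V: "V_norm v n w > 0"
  shows "M_ratio v n w \<le> \<eta> \<longleftrightarrow> (\<forall>i\<in>{1..n}. (cwt v n i w / V_norm v n w)\<^sup>2 \<le> \<eta>)"
proof -
  have "(MAX i\<in>{1..n}. (cwt v n i w)\<^sup>2) \<le> \<eta> * (V_norm v n w)\<^sup>2
      \<longleftrightarrow> (\<forall>i\<in>{1..n}. (cwt v n i w)\<^sup>2 \<le> \<eta> * (V_norm v n w)\<^sup>2)"
    using assms(1) by (subst Max_le_iff) auto
  then show ?thesis
    using V by (simp add: M_ratio_def V_norm_square[symmetric] power_divide pos_divide_le_eq del: One_nat_def)
qed

lemma M_ratio_nonneg:
  assumes "n \<ge> 1"
  shows "M_ratio v n w \<ge> 0"
proof -
  have "(cwt v n 1 w)\<^sup>2 \<le> (MAX i\<in>{1..n}. (cwt v n i w)\<^sup>2)" using assms by (intro Max_ge) auto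
  then have "0 \<le> (MAX i\<in>{1..n}. (cwt v n i w)\<^sup>2)" by (rule order_trans[OF zero_le_power2])
  then show ?thesis unfolding M_ratio_def by (intro divide_nonneg_nonneg sum_nonneg) auto
qed

locale weighted_bootstrap = PX: centered_iid PX X \<sigma> + Pv: prob_space Pv
  for PX :: "'a measure" and X \<sigma> and Pv :: "'b measure" +
  fixes v :: "nat \<Rightarrow> nat \<Rightarrow> 'b \<Rightarrow> real"
  assumes v_meas: "\<And>n i. i \<in> {1..n} \<Longrightarrow> v n i \<in> borel_measurable Pv"
    and v_nonneg: "\<And>n i. i \<in> {1..n} \<Longrightarrow> AE w in Pv. 0 \<le> v n i w"
    and m_ge_1: "\<And>n. n \<ge> 1 \<Longrightarrow> AE w in Pv. 1 \<le> m_tot v n w"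
    and V_pos: "\<And>n. n \<ge> 2 \<Longrightarrow> AE w in Pv. 0 < V_norm v n w"
begin

abbreviation W :: "nat \<Rightarrow> 'b measure" where "W n \<equiv> weight_algebra Pv v n"

abbreviation cprob :: "nat \<Rightarrow> ('a \<Rightarrow> 'b \<Rightarrow> bool) \<Rightarrow> 'b \<Rightarrow> real" where
  "cprob n Q \<equiv> P_X_given_v PX Pv v n Q"

definition weight_adapted :: "nat \<Rightarrow> ('a \<Rightarrow> 'b \<Rightarrow> real) \<Rightarrow> bool" where
  "weight_adapted n f \<longleftrightarrow> (\<lambda>z. f (fst z) (snd z)) \<in> borel_measurable (PX \<Otimes>\<^sub>M W n)"

lemma weight_adapted_section:
  assumes "weight_adapted n f" "w \<in> space Pv"
  shows "(\<lambda>x. f x w) \<in> borel_measurable PX"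
  using measurable_Pair1[OF assms(1)[unfolded weight_adapted_def], of w] assms(2) by simp

lemma cprob_eq:
  assumes f: "weight_adapted n f" and B: "B \<in> sets borel"
  shows "AE w in Pv. cprob n (\<lambda>x w. f x w \<in> B) w = PX.prob {x \<in> space PX. f x w \<in> B}"
proof (rule P_X_given_v_eq_section_prob)
  have "space (PX \<Otimes>\<^sub>M Pv) = space (PX \<Otimes>\<^sub>M W n)" by (simp add: space_pair_measure)
  then have "{z \<in> space (PX \<Otimes>\<^sub>M Pv). f (fst z) (snd z) \<in> B}
      = (\<lambda>z. f (fst z) (snd z)) -` B \<inter> space (PX \<Otimes>\<^sub>M W n)" by auto
  also have "\<dots> \<in> sets (PX \<Otimes>\<^sub>M W n)"
    using f B unfolding weight_adapted_def by (rule measurable_sets)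
  finally show "{z \<in> space (PX \<Otimes>\<^sub>M Pv). f (fst z) (snd z) \<in> B} \<in> sets (PX \<Otimes>\<^sub>M W n)" .
qed (use v_meas PX.prob_space_axioms Pv.prob_space_axioms in auto)

lemma cprob_gt_eq:
  assumes "weight_adapted n f"
  shows "AE w in Pv. cprob n (\<lambda>x w. f x w > c) w = PX.prob {x \<in> space PX. f x w > c}"
  using cprob_eq[OF assms, of "{c<..}"] by simp

lemma cprob_le_eq:
  assumes "weight_adapted n f"
  shows "AE w in Pv. cprob n (\<lambda>x w. f x w \<le> c) w = PX.prob {x \<in> space PX. f x w \<le> c}"
  using cprob_eq[OF assms, of "{..c}"] by simp

lemma X_adapted: "i \<in> {1..n} \<Longrightarrow> (\<lambda>z. X i (fst z)) \<in> borel_measurable (PX \<Otimes>\<^sub>M W n)"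
  by (rule measurable_compose[OF measurable_fst PX.rv]) simp

lemma v_adapted: "i \<in> {1..n} \<Longrightarrow> (\<lambda>z. v n i (snd z)) \<in> borel_measurable (PX \<Otimes>\<^sub>M W n)"
  by (rule measurable_compose[OF measurable_snd weight_measurable])

lemma m_tot_adapted: "(\<lambda>z. m_tot v n (snd z)) \<in> borel_measurable (PX \<Otimes>\<^sub>M W n)"
  unfolding m_tot_def by (intro borel_measurable_sum v_adapted)

lemma cwt_adapted: "i \<in> {1..n} \<Longrightarrow> (\<lambda>z. cwt v n i (snd z)) \<in> borel_measurable (PX \<Otimes>\<^sub>M W n)"
  unfolding cwt_def
  by (intro borel_measurable_diff borel_measurable_divide v_adapted m_tot_adapted borel_measurable_const)

lemma cwt_square_sum_adapted:
  "(\<lambda>z. \<Sum>i=1..n. (cwt v n i (snd z))\<^sup>2) \<in> borel_measurable (PX \<Otimes>\<^sub>M W n)"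
  by (intro borel_measurable_sum borel_measurable_power cwt_adapted)

lemma V_norm_adapted: "(\<lambda>z. V_norm v n (snd z)) \<in> borel_measurable (PX \<Otimes>\<^sub>M W n)"
  unfolding V_norm_def using cwt_square_sum_adapted by measurable

lemma numerator_adapted:
  "(\<lambda>z. \<Sum>i=1..n. cwt v n i (snd z) * X i (fst z)) \<in> borel_measurable (PX \<Otimes>\<^sub>M W n)"
  by (intro borel_measurable_sum borel_measurable_times cwt_adapted X_adapted)

lemma boot_mean_adapted:
  "(\<lambda>z. boot_mean X v n (fst z) (snd z)) \<in> borel_measurable (PX \<Otimes>\<^sub>M W n)"
  unfolding boot_mean_def
  by (intro borel_measurable_sum borel_measurable_times borel_measurable_divide borel_measurable_const
      m_tot_adapted v_adapted X_adapted)

lemma boot_var_adapted: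
  "(\<lambda>z. boot_var X v n (fst z) (snd z)) \<in> borel_measurable (PX \<Otimes>\<^sub>M W n)"
  unfolding boot_var_def
  by (intro borel_measurable_sum borel_measurable_times borel_measurable_divide borel_measurable_const
      borel_measurable_power borel_measurable_diff m_tot_adapted v_adapted X_adapted boot_mean_adapted)

lemma boot_se_adapted: "weight_adapted n (boot_se X v n)"
  unfolding boot_se_def weight_adapted_def using boot_var_adapted m_tot_adapted by measurable

lemma sd_V_norm_adapted: "weight_adapted n (\<lambda>x w. sample_sd X n x * V_norm v n w)"
  unfolding weight_adapted_def
  by (intro borel_measurable_times V_norm_adapted measurable_compose[OF measurable_fst PX.sample_sd_rv])

lemma M_ratio_measurable:
  shows "M_ratio v n \<in> borel_measurable Pv"
proof -
  have v: "v n i \<in> borel_measurable Pv" if "i \<in> {1..n}" for i by (rule v_meas[OF that])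
  have m: "m_tot v n \<in> borel_measurable Pv"
    unfolding m_tot_def[abs_def] by (intro borel_measurable_sum v)
  have c: "cwt v n i \<in> borel_measurable Pv" if "i \<in> {1..n}" for i
    unfolding cwt_def[abs_def] using that
    by (intro borel_measurable_diff borel_measurable_divide v m borel_measurable_const)
  show ?thesis
    unfolding M_ratio_def[abs_def]
    by (intro borel_measurable_divide borel_measurable_Max borel_measurable_sum borel_measurable_power c) auto
qed

end

locale weighted_bootstrap_limit = weighted_bootstrap PX X \<sigma> Pv v + limit_mode Pv Lim
  for PX :: "'a measure" and X \<sigma> and Pv :: "'b measure" and v Lim
begin

text \<open>
  The \<open>\<epsilon>\<close>-\<open>\<eta>\<close> statements for fixed weights are applied, for almost every \<open>w\<close>, to the
  normalized weights and to \<open>D = den / V_norm\<close>; the \<open>transfer\<close> rule of the mode then gives the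
  three implications, with the conditional probability that \<open>D / \<sigma>\<close> is off by more than \<open>\<eta>\<close> as
  the second null sequence.
\<close>

lemma clt_iff_small_weights:
  assumes adapted: "\<And>n. n \<ge> 2 \<Longrightarrow> weight_adapted n (den n)"
    and consistent: "\<And>\<eta>. \<eta> > 0 \<Longrightarrow>
      Lim (\<lambda>n. cprob n (\<lambda>x w. \<bar>den n x w / (\<sigma> * V_norm v n w) - 1\<bar> > \<eta>)) 0"
  shows "Lim (M_ratio v) 0 \<longleftrightarrow>
    (\<forall>t. Lim (\<lambda>n. cprob n (\<lambda>x w. (\<Sum>i=1..n. cwt v n i w * X i x) / den n x w \<le> t))
      (cdf std_normal_distribution t)) \<and>
    (\<forall>\<epsilon>>0. Lim (\<lambda>n w. MAX i\<in>{1..n}. cprob n (\<lambda>x w. V_abs X v n i x w / den n x w > \<epsilon>) w) 0)"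
proof -
  let ?D = "\<lambda>n w x. den n x w / V_norm v n w" and ?a = "\<lambda>n w i. cwt v n i w / V_norm v n w"
  let ?C = "\<lambda>\<eta> n. cprob n (\<lambda>x w. \<bar>den n x w / (\<sigma> * V_norm v n w) - 1\<bar> > \<eta>)"
  let ?T = "\<lambda>t n. cprob n (\<lambda>x w. (\<Sum>i=1..n. cwt v n i w * X i x) / den n x w \<le> t)"
  let ?N = "\<lambda>\<epsilon> n w i. cprob n (\<lambda>x w. V_abs X v n i x w / den n x w > \<epsilon>) w"
  have meas: "cprob n Q \<in> borel_measurable Pv" for n Q
    by (rule P_X_given_v_measurable[OF PX.prob_space_axioms])
  have D_meas: "?D n w \<in> borel_measurable PX" if "n \<ge> 2" "w \<in> space Pv" for n w
    using weight_adapted_section[OF adapted that(2)] that(1) by measurable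
  \<comment> \<open>The conditional probabilities, written with the normalized weights and denominator.\<close>
  have C_eq: "AE w in Pv. ?C \<eta> n w = PX.prob {x \<in> space PX. \<bar>?D n w x / \<sigma> - 1\<bar> > \<eta>}" if "n \<ge> 2" for \<eta> n
  proof -
    have "weight_adapted n (\<lambda>x w. \<bar>den n x w / (\<sigma> * V_norm v n w) - 1\<bar>)"
      using adapted[OF that] V_norm_adapted[of n] unfolding weight_adapted_def by measurable
    from cprob_gt_eq[OF this] show ?thesis by (simp add: divide_divide_eq_left mult.commute)
  qed
  have T_eq: "AE w in Pv. ?T t n w = PX.prob {x \<in> space PX. (\<Sum>i=1..n. ?a n w i * X i x) / ?D n w x \<le> t}"
    if "n \<ge> 2" for t n
  proof -
    have "weight_adapted n (\<lambda>x w. (\<Sum>i=1..n. cwt v n i w * X i x) / den n x w)"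
      using adapted[OF that] numerator_adapted[of n] unfolding weight_adapted_def by measurable
    from cprob_le_eq[OF this, of t] V_pos[OF that] show ?thesis
    proof eventually_elim
      case (elim w)
      have eq: "(\<Sum>i=1..n. ?a n w i * X i x) / ?D n w x = (\<Sum>i=1..n. cwt v n i w * X i x) / den n x w" for x
      proof -
        have "(\<Sum>i=1..n. ?a n w i * X i x) = (\<Sum>i=1..n. cwt v n i w * X i x) / V_norm v n w"
          by (simp add: sum_divide_distrib)
        then show ?thesis using elim(2) by (simp only:) simp
      qed
      show ?case unfolding eq by (rule elim(1))
    qed
  qed
  have N_eq: "AE w in Pv. \<forall>i\<in>{1..n}. ?N \<epsilon> n w i = PX.prob {x \<in> space PX. \<bar>?a n w i * X i x\<bar> / ?D n w x > \<epsilon>}"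
    if "n \<ge> 2" for \<epsilon> n
  proof (intro AE_finite_allI)
    fix i assume i: "i \<in> {1..n}"
    have "weight_adapted n (\<lambda>x w. V_abs X v n i x w / den n x w)"
      using adapted[OF that] cwt_adapted[OF i] X_adapted[OF i] unfolding weight_adapted_def V_abs_def
      by measurable
    from cprob_gt_eq[OF this, of \<epsilon>] V_pos[OF that]
    show "AE w in Pv. ?N \<epsilon> n w i = PX.prob {x \<in> space PX. \<bar>?a n w i * X i x\<bar> / ?D n w x > \<epsilon>}"
    proof eventually_elim
      case (elim w)
      have eq: "\<bar>?a n w i * X i x\<bar> / ?D n w x = V_abs X v n i x w / den n x w" for x
        using elim(2) by (simp add: V_abs_def abs_mult field_simps)
      show ?case unfolding eq by (rule elim(1))
    qed
  qed simp
  show ?thesis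
  proof (intro iffI conjI allI impI)
    assume M: "Lim (M_ratio v) 0"
    fix t
    show "Lim (?T t) (cdf std_normal_distribution t)"
    proof (rule transfer)
      fix \<delta> :: real assume "\<delta> > 0"
      from PX.studentized_sum_clt[OF this, of t] obtain \<eta> where \<eta>: "\<eta> > 0" and
        clt: "\<And>n a D. (\<Sum>i=1..n. (a i)\<^sup>2) = 1 \<Longrightarrow> \<forall>i\<in>{1..n}. (a i)\<^sup>2 \<le> \<eta> \<Longrightarrow>
          D \<in> borel_measurable PX \<Longrightarrow> PX.prob {x \<in> space PX. \<bar>D x / \<sigma> - 1\<bar> > \<eta>} \<le> \<eta> \<Longrightarrow>
          \<bar>PX.prob {x \<in> space PX. (\<Sum>i=1..n. a i * X i x) / D x \<le> t} - cdf std_normal_distribution t\<bar> \<le> \<delta>"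
        by blast
      have control: "AE w in Pv. \<bar>M_ratio v n w\<bar> \<le> \<eta> \<and> \<bar>?C \<eta> n w\<bar> \<le> \<eta> \<longrightarrow> \<bar>?T t n w - cdf std_normal_distribution t\<bar> \<le> \<delta>"
        if n: "n \<ge> 2" for n
        using C_eq[OF n, of \<eta>] T_eq[OF n, of t] V_pos[OF n] AE_space
      proof eventually_elim
        case (elim w)
        show ?case
        proof
          assume *: "\<bar>M_ratio v n w\<bar> \<le> \<eta> \<and> \<bar>?C \<eta> n w\<bar> \<le> \<eta>"
          show "\<bar>?T t n w - cdf std_normal_distribution t\<bar> \<le> \<delta>"
            unfolding elim(2)
          proof (rule clt[OF normalized_cwt_square_sum[OF elim(3)]])
            show "\<forall>i\<in>{1..n}. (?a n w i)\<^sup>2 \<le> \<eta>"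
              using * M_ratio_le_iff[OF _ elim(3), of \<eta>] n by auto
            show "PX.prob {x \<in> space PX. \<bar>?D n w x / \<sigma> - 1\<bar> > \<eta>} \<le> \<eta>"
              using * elim(1) by simp
          qed (use elim n in \<open>auto intro: D_meas\<close>)
        qed
      qed
      show "\<exists>A B \<eta>. \<eta> > 0 \<and> Lim A 0 \<and> Lim B 0 \<and> (\<forall>n\<ge>2. A n \<in> borel_measurable Pv \<and> B n \<in> borel_measurable Pv \<and>
          (AE w in Pv. \<bar>A n w\<bar> \<le> \<eta> \<and> \<bar>B n w\<bar> \<le> \<eta> \<longrightarrow> \<bar>?T t n w - cdf std_normal_distribution t\<bar> \<le> \<delta>))"
        by (rule control_by_null_sequences[where Lim=Lim, OF \<eta> M consistent[OF \<eta>]])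
          (rule M_ratio_measurable, rule meas, erule control)
    qed
  next
    assume M: "Lim (M_ratio v) 0"
    fix \<epsilon> :: real assume \<epsilon>: "\<epsilon> > 0"
    show "Lim (\<lambda>n w. MAX i\<in>{1..n}. ?N \<epsilon> n w i) 0"
    proof (rule transfer)
      fix \<delta> :: real assume "\<delta> > 0"
      from PX.small_weights_imp_negligible[OF \<epsilon> this] obtain \<eta> where \<eta>: "\<eta> > 0" and
        negl: "\<And>i b D. i \<ge> 1 \<Longrightarrow> b\<^sup>2 \<le> \<eta> \<Longrightarrow> D \<in> borel_measurable PX \<Longrightarrow>
          PX.prob {x \<in> space PX. \<bar>D x / \<sigma> - 1\<bar> > \<eta>} \<le> \<eta> \<Longrightarrow>
          PX.prob {x \<in> space PX. \<bar>b * X i x\<bar> / D x > \<epsilon>} \<le> \<delta>"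
        by blast
      have control: "AE w in Pv. \<bar>M_ratio v n w\<bar> \<le> \<eta> \<and> \<bar>?C \<eta> n w\<bar> \<le> \<eta> \<longrightarrow> \<bar>(MAX i\<in>{1..n}. ?N \<epsilon> n w i) - 0\<bar> \<le> \<delta>"
        if n: "n \<ge> 2" for n
        using C_eq[OF n, of \<eta>] N_eq[OF n, of \<epsilon>] V_pos[OF n] AE_space
      proof eventually_elim
        case (elim w)
        show ?case
        proof
          assume *: "\<bar>M_ratio v n w\<bar> \<le> \<eta> \<and> \<bar>?C \<eta> n w\<bar> \<le> \<eta>"
          have "\<forall>i\<in>{1..n}. (?a n w i)\<^sup>2 \<le> \<eta>"
            using * M_ratio_le_iff[OF _ elim(3), of \<eta>] n by auto
          then have le: "?N \<epsilon> n w i \<le> \<delta>" if "i \<in> {1..n}" for i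
            using that elim(2) * elim(1) D_meas[OF n elim(4)] negl[of i "?a n w i" "?D n w"] by auto
          have "(MAX i\<in>{1..n}. ?N \<epsilon> n w i) \<in> ?N \<epsilon> n w ` {1..n}"
            using n by (intro Max_in) auto
          then obtain i where i: "i \<in> {1..n}" "(MAX i\<in>{1..n}. ?N \<epsilon> n w i) = ?N \<epsilon> n w i" by blast
          then have "0 \<le> ?N \<epsilon> n w i" using elim(2) by simp
          then show "\<bar>(MAX i\<in>{1..n}. ?N \<epsilon> n w i) - 0\<bar> \<le> \<delta>" using le[OF i(1)] i(2) by simp
        qed
      qed
      show "\<exists>A B \<eta>. \<eta> > 0 \<and> Lim A 0 \<and> Lim B 0 \<and> (\<forall>n\<ge>2. A n \<in> borel_measurable Pv \<and> B n \<in> borel_measurable Pv \<and>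
          (AE w in Pv. \<bar>A n w\<bar> \<le> \<eta> \<and> \<bar>B n w\<bar> \<le> \<eta> \<longrightarrow> \<bar>(MAX i\<in>{1..n}. ?N \<epsilon> n w i) - 0\<bar> \<le> \<delta>))"
        by (rule control_by_null_sequences[where Lim=Lim, OF \<eta> M consistent[OF \<eta>]])
          (rule M_ratio_measurable, rule meas, erule control)
    qed
  next
    assume asm: "(\<forall>t. Lim (?T t) (cdf std_normal_distribution t)) \<and>
      (\<forall>\<epsilon>>0. Lim (\<lambda>n w. MAX i\<in>{1..n}. ?N \<epsilon> n w i) 0)"
    show "Lim (M_ratio v) 0"
    proof (rule transfer)
      fix \<delta> :: real assume "\<delta> > 0"
      from PX.negligible_imp_small_weights[OF this] obtain \<epsilon> \<eta> where \<epsilon>: "\<epsilon> > 0" and \<eta>: "\<eta> > 0" and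
        small: "\<And>i b D. i \<ge> 1 \<Longrightarrow> D \<in> borel_measurable PX \<Longrightarrow>
          PX.prob {x \<in> space PX. \<bar>D x / \<sigma> - 1\<bar> > \<eta>} \<le> \<eta> \<Longrightarrow>
          PX.prob {x \<in> space PX. \<bar>b * X i x\<bar> / D x > \<epsilon>} \<le> \<eta> \<Longrightarrow> b\<^sup>2 \<le> \<delta>"
        by blast
      have control: "AE w in Pv. \<bar>MAX i\<in>{1..n}. ?N \<epsilon> n w i\<bar> \<le> \<eta> \<and> \<bar>?C \<eta> n w\<bar> \<le> \<eta> \<longrightarrow> \<bar>M_ratio v n w - 0\<bar> \<le> \<delta>"
        if n: "n \<ge> 2" for n
        using C_eq[OF n, of \<eta>] N_eq[OF n, of \<epsilon>] V_pos[OF n] AE_space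
      proof eventually_elim
        case (elim w)
        show ?case
        proof
          assume *: "\<bar>MAX i\<in>{1..n}. ?N \<epsilon> n w i\<bar> \<le> \<eta> \<and> \<bar>?C \<eta> n w\<bar> \<le> \<eta>"
          have "(?a n w i)\<^sup>2 \<le> \<delta>" if i: "i \<in> {1..n}" for i
          proof (rule small[of i "?D n w"])
            have max: "?N \<epsilon> n w i \<le> (MAX i\<in>{1..n}. ?N \<epsilon> n w i)" using i by (intro Max_ge) auto
            show "PX.prob {x \<in> space PX. \<bar>?a n w i * X i x\<bar> / ?D n w x > \<epsilon>} \<le> \<eta>"
              unfolding bspec[OF elim(2) i, symmetric]
              by (rule order_trans[OF max order_trans[OF abs_ge_self conjunct1[OF *]]])
            show "PX.prob {x \<in> space PX. \<bar>?D n w x / \<sigma> - 1\<bar> > \<eta>} \<le> \<eta>"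
              using * elim(1) by simp
          qed (use i elim n in \<open>auto intro: D_meas\<close>)
          then have "M_ratio v n w \<le> \<delta>" using M_ratio_le_iff[OF _ elim(3), of \<delta>] n by auto
          then show "\<bar>M_ratio v n w - 0\<bar> \<le> \<delta>" using M_ratio_nonneg[of n v w] n by simp
        qed
      qed
      have max_meas: "(\<lambda>w. MAX i\<in>{1..n}. ?N \<epsilon> n w i) \<in> borel_measurable Pv" for n
        by (intro borel_measurable_Max meas) auto
      have max_null: "Lim (\<lambda>n w. MAX i\<in>{1..n}. ?N \<epsilon> n w i) 0" using asm \<epsilon> by blast
      show "\<exists>A B \<eta>. \<eta> > 0 \<and> Lim A 0 \<and> Lim B 0 \<and> (\<forall>n\<ge>2. A n \<in> borel_measurable Pv \<and> B n \<in> borel_measurable Pv \<and>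
          (AE w in Pv. \<bar>A n w\<bar> \<le> \<eta> \<and> \<bar>B n w\<bar> \<le> \<eta> \<longrightarrow> \<bar>M_ratio v n w - 0\<bar> \<le> \<delta>))"
        by (rule control_by_null_sequences[where Lim=Lim, OF \<eta> max_null consistent[OF \<eta>]])
          (rule max_meas, rule meas, erule control)
    qed
  qed
qed

text \<open>
  The factor \<open>V_norm\<close> cancels, so the conditional probability is almost surely a deterministic
  sequence.
\<close>

lemma sample_sd_conditionally_consistent:
  assumes \<eta>: "\<eta> > 0"
  shows "Lim (\<lambda>n. cprob n (\<lambda>x w. \<bar>sample_sd X n x * V_norm v n w / (\<sigma> * V_norm v n w) - 1\<bar> > \<eta>)) 0"
    (is "Lim ?Y 0")
proof (rule transfer)
  let ?c = "\<lambda>n. PX.prob {x \<in> space PX. \<bar>sample_sd X n x / \<sigma> - 1\<bar> > \<eta>}"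
  fix \<delta> :: real assume \<delta>: "\<delta> > 0"
  have control: "AE w in Pv. \<bar>?c n\<bar> \<le> \<delta> \<and> \<bar>?c n\<bar> \<le> \<delta> \<longrightarrow> \<bar>?Y n w - 0\<bar> \<le> \<delta>" if n: "n \<ge> 2" for n
  proof -
    have "weight_adapted n (\<lambda>x w. \<bar>sample_sd X n x * V_norm v n w / (\<sigma> * V_norm v n w) - 1\<bar>)"
      using sd_V_norm_adapted[of n] V_norm_adapted[of n] unfolding weight_adapted_def by measurable
    from cprob_gt_eq[OF this, of \<eta>] V_pos[OF n] show ?thesis
      by eventually_elim auto
  qed
  have null: "Lim (\<lambda>n w. ?c n) 0" by (rule deterministic[OF PX.sample_sd_consistent[OF \<eta>]])
  show "\<exists>A B \<eta>. \<eta> > 0 \<and> Lim A 0 \<and> Lim B 0 \<and> (\<forall>n\<ge>2. A n \<in> borel_measurable Pv \<and> B n \<in> borel_measurable Pv \<and>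
      (AE w in Pv. \<bar>A n w\<bar> \<le> \<eta> \<and> \<bar>B n w\<bar> \<le> \<eta> \<longrightarrow> \<bar>?Y n w - 0\<bar> \<le> \<delta>))"
    by (rule control_by_null_sequences[where Lim=Lim, OF \<delta> null null])
      (rule borel_measurable_const, rule borel_measurable_const, erule control)
qed

text \<open>
  With \<open>s = boot_se / (\<sigma> * V_norm)\<close> the variance ratio in the assumption is \<open>s\<^sup>2\<close>. This uses
  \<open>boot_var \<ge> 0\<close>, where the weights have to be nonnegative.
\<close>

lemma boot_se_conditionally_consistent:
  assumes var: "\<And>\<epsilon>. \<epsilon> > 0 \<Longrightarrow> Lim (\<lambda>n. cprob n (\<lambda>x w.
      \<bar>(boot_var X v n x w / m_tot v n w) / (\<sigma>\<^sup>2 * (\<Sum>i=1..n. (cwt v n i w)\<^sup>2)) - 1\<bar> > \<epsilon>)) 0"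
    and \<eta>: "\<eta> > 0"
  shows "Lim (\<lambda>n. cprob n (\<lambda>x w. \<bar>boot_se X v n x w / (\<sigma> * V_norm v n w) - 1\<bar> > \<eta>)) 0"
    (is "Lim ?Y 0")
proof (rule transfer)
  let ?r = "\<lambda>n x w. (boot_var X v n x w / m_tot v n w) / (\<sigma>\<^sup>2 * (\<Sum>i=1..n. (cwt v n i w)\<^sup>2))"
  let ?A = "\<lambda>n. cprob n (\<lambda>x w. \<bar>?r n x w - 1\<bar> > \<eta>)"
  have meas: "?A n \<in> borel_measurable Pv" for n
    by (rule P_X_given_v_measurable[OF PX.prob_space_axioms])
  fix \<delta> :: real assume \<delta>: "\<delta> > 0"
  have control: "AE w in Pv. \<bar>?A n w\<bar> \<le> \<delta> \<and> \<bar>?A n w\<bar> \<le> \<delta> \<longrightarrow> \<bar>?Y n w - 0\<bar> \<le> \<delta>" if n: "n \<ge> 2" for n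
  proof -
    have a: "weight_adapted n (\<lambda>x w. \<bar>boot_se X v n x w / (\<sigma> * V_norm v n w) - 1\<bar>)"
      using boot_se_adapted[of n] V_norm_adapted[of n] unfolding weight_adapted_def by measurable
    have b: "weight_adapted n (\<lambda>x w. \<bar>?r n x w - 1\<bar>)"
      using boot_var_adapted[of n] m_tot_adapted[of n] cwt_square_sum_adapted[of n]
      unfolding weight_adapted_def by measurable
    have nonneg: "AE w in Pv. \<forall>i\<in>{1..n}. 0 \<le> v n i w"
      by (intro AE_finite_allI v_nonneg) auto
    have m: "AE w in Pv. 1 \<le> m_tot v n w" using n by (intro m_ge_1) simp
    from cprob_gt_eq[OF a, of \<eta>] cprob_gt_eq[OF b, of \<eta>] V_pos[OF n] nonneg m AE_space
    show ?thesis
    proof eventually_elim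
      case (elim w)
      have "\<bar>boot_se X v n x w / (\<sigma> * V_norm v n w) - 1\<bar> \<le> \<bar>?r n x w - 1\<bar>" for x
      proof -
        let ?s = "boot_se X v n x w / (\<sigma> * V_norm v n w)"
        have "boot_var X v n x w \<ge> 0"
          unfolding boot_var_def using elim(4,5) by (intro mult_nonneg_nonneg sum_nonneg) auto
        then have "?s\<^sup>2 = ?r n x w" and "?s \<ge> 0"
          using elim(3,5) PX.\<sigma>_pos
          by (simp_all add: boot_se_def power_divide power_mult_distrib V_norm_square)
        then show ?thesis using abs_minus_one_le_abs_square_minus_one[of ?s] by simp
      qed
      then have "PX.prob {x \<in> space PX. \<bar>boot_se X v n x w / (\<sigma> * V_norm v n w) - 1\<bar> > \<eta>}
          \<le> PX.prob {x \<in> space PX. \<bar>?r n x w - 1\<bar> > \<eta>}"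
        using weight_adapted_section[OF b elim(6)]
        by (intro PX.finite_measure_mono) (auto intro: order.strict_trans2)
      then show ?case using elim(1,2) by simp
    qed
  qed
  show "\<exists>A B \<eta>. \<eta> > 0 \<and> Lim A 0 \<and> Lim B 0 \<and> (\<forall>n\<ge>2. A n \<in> borel_measurable Pv \<and> B n \<in> borel_measurable Pv \<and>
      (AE w in Pv. \<bar>A n w\<bar> \<le> \<eta> \<and> \<bar>B n w\<bar> \<le> \<eta> \<longrightarrow> \<bar>?Y n w - 0\<bar> \<le> \<delta>))"
    by (rule control_by_null_sequences[where Lim=Lim, OF \<delta> var[OF \<eta>] var[OF \<eta>]])
      (rule meas, rule meas, erule control)
qed

lemma T_star_equivalence:
  "Lim (M_ratio v) 0 \<longleftrightarrow>
    (\<forall>t. Lim (\<lambda>n. cprob n (\<lambda>x w. T_star X v n x w \<le> t)) (cdf std_normal_distribution t)) \<and>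
    (\<forall>\<epsilon>>0. Lim (\<lambda>n w. MAX i\<in>{1..n}. cprob n
      (\<lambda>x w. V_abs X v n i x w / (sample_sd X n x * V_norm v n w) > \<epsilon>) w) 0)"
  unfolding T_star_def
  by (rule clt_iff_small_weights[OF sd_V_norm_adapted sample_sd_conditionally_consistent])

lemma T_star_star_equivalence:
  assumes "\<And>\<epsilon>. \<epsilon> > 0 \<Longrightarrow> Lim (\<lambda>n. cprob n (\<lambda>x w.
      \<bar>(boot_var X v n x w / m_tot v n w) / (\<sigma>\<^sup>2 * (\<Sum>i=1..n. (cwt v n i w)\<^sup>2)) - 1\<bar> > \<epsilon>)) 0"
  shows "Lim (M_ratio v) 0 \<longleftrightarrow>
    (\<forall>t. Lim (\<lambda>n. cprob n (\<lambda>x w. T_star_star X v n x w \<le> t)) (cdf std_normal_distribution t)) \<and>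
    (\<forall>\<epsilon>>0. Lim (\<lambda>n w. MAX i\<in>{1..n}. cprob n (\<lambda>x w. V_abs X v n i x w / boot_se X v n x w > \<epsilon>) w) 0)"
  unfolding T_star_star_def
  by (rule clt_iff_small_weights[OF boot_se_adapted boot_se_conditionally_consistent[OF assms]])

end

theorem theorem2p1:
  fixes PX :: "'a measure" and Pv :: "'b measure"
    and X :: "nat \<Rightarrow> 'a \<Rightarrow> real" and v :: "nat \<Rightarrow> nat \<Rightarrow> 'b \<Rightarrow> real" and \<sigma> :: real
  assumes PX: "prob_space PX" and Pv: "prob_space Pv"
    and X_indep: "prob_space.indep_vars PX (\<lambda>i. borel) X {1..}"
    and X_ident: "\<And>i. i \<ge> 1 \<Longrightarrow> distr PX borel (X i) = distr PX borel (X 1)"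
    and X_sq_int: "integrable PX (\<lambda>x. (X 1 x)\<^sup>2)"
    and X_mean: "(\<integral>x. X 1 x \<partial>PX) = 0"
    and sigma_pos: "0 < \<sigma>"
    and X_var: "(\<integral>x. (X 1 x - (\<integral>y. X 1 y \<partial>PX))\<^sup>2 \<partial>PX) = \<sigma>\<^sup>2"
    and v_meas: "\<And>n i. i \<in> {1..n} \<Longrightarrow> v n i \<in> borel_measurable Pv"
    and v_nonneg: "\<And>n i. i \<in> {1..n} \<Longrightarrow> AE w in Pv. 0 \<le> v n i w"
    and m_ge_1: "\<And>n. n \<ge> 1 \<Longrightarrow> AE w in Pv. 1 \<le> m_tot v n w"
    and m_lim: "AE w in Pv. filterlim (\<lambda>n. m_tot v n w) at_top sequentially"
    and V_pos: "\<And>n. n \<ge> 2 \<Longrightarrow> AE w in Pv. 0 < V_norm v n w"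
  shows
    "(tendsto_as Pv (M_ratio v) 0 \<longleftrightarrow>
        (\<forall>t. tendsto_as Pv
           (\<lambda>n. P_X_given_v PX Pv v n (\<lambda>x w. T_star X v n x w \<le> t))
           (cdf std_normal_distribution t)) \<and>
        (\<forall>\<epsilon>>0. tendsto_as Pv
           (\<lambda>n w. MAX i\<in>{1..n}. P_X_given_v PX Pv v n
              (\<lambda>x w. V_abs X v n i x w / (sample_sd X n x * V_norm v n w) > \<epsilon>) w) 0))
   \<and> (tendsto_in_prob Pv (M_ratio v) 0 \<longleftrightarrow>
        (\<forall>t. tendsto_in_prob Pv
           (\<lambda>n. P_X_given_v PX Pv v n (\<lambda>x w. T_star X v n x w \<le> t))
           (cdf std_normal_distribution t)) \<and>
        (\<forall>\<epsilon>>0. tendsto_in_prob Pv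
           (\<lambda>n w. MAX i\<in>{1..n}. P_X_given_v PX Pv v n
              (\<lambda>x w. V_abs X v n i x w / (sample_sd X n x * V_norm v n w) > \<epsilon>) w) 0))
   \<and> ((\<forall>\<epsilon>>0. tendsto_as Pv
           (\<lambda>n. P_X_given_v PX Pv v n (\<lambda>x w.
              \<bar>(boot_var X v n x w / m_tot v n w) / (\<sigma>\<^sup>2 * (\<Sum>i=1..n. (cwt v n i w)\<^sup>2)) - 1\<bar> > \<epsilon>)) 0)
      \<longrightarrow>
      (tendsto_as Pv (M_ratio v) 0 \<longleftrightarrow>
        (\<forall>t. tendsto_as Pv
           (\<lambda>n. P_X_given_v PX Pv v n (\<lambda>x w. T_star_star X v n x w \<le> t))
           (cdf std_normal_distribution t)) \<and>
        (\<forall>\<epsilon>>0. tendsto_as Pv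
           (\<lambda>n w. MAX i\<in>{1..n}. P_X_given_v PX Pv v n
              (\<lambda>x w. V_abs X v n i x w / boot_se X v n x w > \<epsilon>) w) 0)))
   \<and> ((\<forall>\<epsilon>>0. tendsto_in_prob Pv
           (\<lambda>n. P_X_given_v PX Pv v n (\<lambda>x w.
              \<bar>(boot_var X v n x w / m_tot v n w) / (\<sigma>\<^sup>2 * (\<Sum>i=1..n. (cwt v n i w)\<^sup>2)) - 1\<bar> > \<epsilon>)) 0)
      \<longrightarrow>
      (tendsto_in_prob Pv (M_ratio v) 0 \<longleftrightarrow>
        (\<forall>t. tendsto_in_prob Pv
           (\<lambda>n. P_X_given_v PX Pv v n (\<lambda>x w. T_star_star X v n x w \<le> t))
           (cdf std_normal_distribution t)) \<and>
        (\<forall>\<epsilon>>0. tendsto_in_prob Pv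
           (\<lambda>n w. MAX i\<in>{1..n}. P_X_given_v PX Pv v n
              (\<lambda>x w. V_abs X v n i x w / boot_se X v n x w > \<epsilon>) w) 0)))"
proof -
  interpret PX: prob_space PX by fact
  interpret B: weighted_bootstrap PX X \<sigma> Pv v
  proof (intro weighted_bootstrap.intro centered_iid.intro centered_iid_axioms.intro
      weighted_bootstrap_axioms.intro)
    show "(\<integral>x. (X 1 x)\<^sup>2 \<partial>PX) = \<sigma>\<^sup>2" using X_var X_mean by simp
  qed (fact PX Pv X_indep X_ident X_sq_int X_mean sigma_pos v_meas v_nonneg m_ge_1 V_pos)+
  interpret as: weighted_bootstrap_limit PX X \<sigma> Pv v "tendsto_as Pv"
    by (intro weighted_bootstrap_limit.intro B.weighted_bootstrap_axioms limit_mode_as)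
  interpret ip: weighted_bootstrap_limit PX X \<sigma> Pv v "tendsto_in_prob Pv"
    by (intro weighted_bootstrap_limit.intro B.weighted_bootstrap_axioms limit_mode_in_prob Pv)
  show ?thesis
    by (intro conjI impI as.T_star_equivalence ip.T_star_equivalence
        as.T_star_star_equivalence ip.T_star_star_equivalence) blast+
qed

end
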